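(* Let $\Gamma$ be a finitely generated group. Then $\beta_1(\Gamma)\leq h(\Gamma)$, where $\beta_1(\Gamma)$ is the first $\ell^2$-Betti number of $\Gamma$ and $h(\Gamma)$ is its uniform isoperimetric constant.
   Context: For a locally finite graph $Y$ and a set $A$ of vertices of $Y$, the (edge) boundary $\partial_Y A$ is the set of edges of $Y$ with one extremity in $A$ and the other outside $A$. The isoperimetric constant of $Y$ is $h(Y)=\inf_A |\partial_Y A|/|A|$, the infimum being over all non-empty finite sets $A$ of vertices. For a finite generating set $S$ of $\Gamma$, the Cayley graph of $\Gamma$ with respect to $S$ has vertex set $\Gamma$, with edges given by right multiplication by elements of $S$ (an edge between $g$ and $gs$ for $g\in \Gamma$, $s\in S$); $h_S(\Gamma)$ denotes its isoperimetric constant. The uniform isoperimetric constant is $h(\Gamma)=\inf_S h_S(\Gamma)$, over all finite generating sets $S$ of $\Gamma$. The first $\ell^2$-Betti number $\beta_1(\Gamma)$ is the usual one (Atiyah, Cheeger--Gromov). For $Y$ the Cayley graph of $\Gamma$ with respect to a finite generating set, it equals the Murray--von Neumann dimension $\dim_\Gamma$ of the orthogonal complement of the closure of the space of finitely supported $1$-cycles of $Y$ in the Hilbert space of square-integrable $1$-cycles of $Y$. *)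

theory Defs
  imports "HOL-Analysis.Analysis" "HOL-Algebra.Generated_Groups"
begin

section \<open>Graphs and isoperimetric constants\<close>

text \<open>Graphs are undirected; an edge is the unordered pair \<open>{x, y}\<close> of its extremities.\<close>

definition edge_boundary :: "'v set set \<Rightarrow> 'v set \<Rightarrow> 'v set set" where
  "edge_boundary E A = {e \<in> E. \<exists>x y. e = {x, y} \<and> x \<in> A \<and> y \<notin> A}"

definition isoperimetric_constant :: "'v set \<Rightarrow> 'v set set \<Rightarrow> real" where
  "isoperimetric_constant V E =
     (INF A \<in> {A. A \<subseteq> V \<and> finite A \<and> A \<noteq> {}}. real (card (edge_boundary E A)) / real (card A))"

definition finite_generating_set :: "('a, 'b) monoid_scheme \<Rightarrow> 'a set \<Rightarrow> bool" where
  "finite_generating_set G S \<longleftrightarrow> finite S \<and> S \<subseteq> carrier G \<and> generate G S = carrier G"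

text \<open>
  The Cayley graph is taken as a simple graph: \<open>s\<close> and its inverse give the same edges, and the
  neutral element, if it belongs to \<open>S\<close>, gives no loops.
\<close>

definition cayley_edges :: "('a, 'b) monoid_scheme \<Rightarrow> 'a set \<Rightarrow> 'a set set" where
  "cayley_edges G S =
     {{g, g \<otimes>\<^bsub>G\<^esub> s} | g s. g \<in> carrier G \<and> s \<in> S \<and> g \<otimes>\<^bsub>G\<^esub> s \<noteq> g}"

definition uniform_isoperimetric_constant :: "('a, 'b) monoid_scheme \<Rightarrow> real" where
  "uniform_isoperimetric_constant G =
     (INF S \<in> {S. finite_generating_set G S}. isoperimetric_constant (carrier G) (cayley_edges G S))"

section \<open>Square-summable functions\<close>

text \<open>Elements of \<open>\<ell>\<^sup>2(X)\<close> are extended by zero to the whole type.\<close>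

definition l2 :: "'i set \<Rightarrow> ('i \<Rightarrow> complex) set" where
  "l2 X = {f. (\<forall>x. x \<notin> X \<longrightarrow> f x = 0) \<and> (\<lambda>x. (cmod (f x))\<^sup>2) summable_on X}"

definition l2_inner :: "('i \<Rightarrow> complex) \<Rightarrow> ('i \<Rightarrow> complex) \<Rightarrow> complex" where
  "l2_inner f g = (\<Sum>\<^sub>\<infinity>x. f x * cnj (g x))"

definition l2_norm :: "('i \<Rightarrow> complex) \<Rightarrow> real" where
  "l2_norm f = sqrt (\<Sum>\<^sub>\<infinity>x. (cmod (f x))\<^sup>2)"

definition l2_closure :: "'i set \<Rightarrow> ('i \<Rightarrow> complex) set \<Rightarrow> ('i \<Rightarrow> complex) set" where
  "l2_closure X V = {f \<in> l2 X. \<forall>\<epsilon>>0. \<exists>v\<in>V. l2_norm (\<lambda>x. f x - v x) < \<epsilon>}"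

definition orth_complement_in ::
  "('i \<Rightarrow> complex) set \<Rightarrow> ('i \<Rightarrow> complex) set \<Rightarrow> ('i \<Rightarrow> complex) set" where
  "orth_complement_in W V = {f \<in> W. \<forall>v\<in>V. l2_inner f v = 0}"

text \<open>The orthogonal projection onto \<open>V\<close>; well defined on \<open>\<ell>\<^sup>2(X)\<close> if \<open>V\<close> is a closed subspace of it.\<close>

definition orth_proj :: "('i \<Rightarrow> complex) set \<Rightarrow> ('i \<Rightarrow> complex) \<Rightarrow> ('i \<Rightarrow> complex)" where
  "orth_proj V f = (THE p. p \<in> V \<and> (\<forall>v\<in>V. l2_inner (\<lambda>x. f x - p x) v = 0))"

text \<open>
  Suppose a group \<open>\<Gamma>\<close> acts freely on \<open>X\<close> and \<open>F \<subseteq> X\<close> is a finite set containing exactly one point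
  of each orbit, so that \<open>\<ell>\<^sup>2(X)\<close> is the Hilbert module \<open>\<ell>\<^sup>2(\<Gamma>)\<^sup>n\<close> with \<open>n\<close> the cardinality of \<open>F\<close>.
  For a closed \<open>\<Gamma>\<close>-invariant subspace \<open>V\<close> of \<open>\<ell>\<^sup>2(X)\<close>, the Murray--von Neumann dimension of \<open>V\<close> is
  the canonical trace of the projection onto \<open>V\<close>, namely the sum of its diagonal coefficients over \<open>F\<close>
  (here \<open>indicator {x}\<close> is the basis vector at \<open>x\<close>). The summands are real.
\<close>

definition vn_dim :: "'i set \<Rightarrow> ('i \<Rightarrow> complex) set \<Rightarrow> real" where
  "vn_dim F V = (\<Sum>x\<in>F. Re (l2_inner (orth_proj V (indicator {x})) (indicator {x})))"

section \<open>Cycles and the first \<open>\<ell>\<^sup>2\<close>-Betti number\<close>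

definition oriented_edges :: "'v set set \<Rightarrow> ('v \<times> 'v) set" where
  "oriented_edges E = {(x, y). {x, y} \<in> E}"

text \<open>
  A 1-chain is an antisymmetric function on oriented edges. For a locally finite graph the sum below
  is finite, and it is, up to sign, the coefficient at \<open>x\<close> of the boundary of \<open>c\<close>.
\<close>

definition l2_cycles :: "'v set set \<Rightarrow> ('v \<times> 'v \<Rightarrow> complex) set" where
  "l2_cycles E = {c \<in> l2 (oriented_edges E).
     (\<forall>x y. c (y, x) = - c (x, y)) \<and> (\<forall>x. (\<Sum>y | {x, y} \<in> E. c (x, y)) = 0)}"

definition finite_cycles :: "'v set set \<Rightarrow> ('v \<times> 'v \<Rightarrow> complex) set" where
  "finite_cycles E = {c \<in> l2_cycles E. finite {e. c e \<noteq> 0}}"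

text \<open>
  The first \<open>\<ell>\<^sup>2\<close>-Betti number of \<open>G\<close>, computed on the Cayley graph of a finite generating set \<open>S\<close>.
  Left translation is free on oriented edges, and the oriented edges starting at the
  neutral element represent its orbits, also when some element of \<open>G\<close> inverts an edge.
\<close>

definition l2_betti_1 :: "('a, 'b) monoid_scheme \<Rightarrow> 'a set \<Rightarrow> real" where
  "l2_betti_1 G S =
     (let E = cayley_edges G S in
      vn_dim {e \<in> oriented_edges E. fst e = \<one>\<^bsub>G\<^esub>}
        (orth_complement_in (l2_cycles E) (l2_closure (oriented_edges E) (finite_cycles E))))"

end

theory Submission
  imports Defs
begin

text \<open>
  Let \<open>H\<close> be the orthogonal complement of the finite cycles in the \<open>\<ell>\<^sup>2\<close>-cycles of the Cayley graph of \<open>S\<close>,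
  and let \<open>A\<close> be a finite set of vertices. An element of \<open>H\<close> that vanishes on the boundary of \<open>A\<close>
  restricts to a finite cycle inside \<open>A\<close>, to which it is orthogonal, so it vanishes on every edge that
  meets \<open>A\<close>. Hence restricting \<open>H\<close> to the edges starting in \<open>A\<close> gives a space of dimension at most
  \<open>|\<partial>A|\<close>. The diagonal coefficients of the projection onto \<open>H\<close> at these edges sum to \<open>|A|\<close> times the
  dimension of \<open>H\<close> by invariance, and to at most that rank, so the dimension is at most \<open>|\<partial>A| / |A|\<close>.

  It remains to see that the dimension does not depend on the generating set. Elements of \<open>H\<close> are the
  divergence-free gradients. The identity on functions induces a bounded equivariant isomorphism
  between the \<open>\<ell>\<^sup>2\<close>-gradients for two generating sets. Its adjoint preserves being
  divergence-free, since this means being orthogonal to the gradients of point masses, and thus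
  restricts to an isomorphism of the harmonic spaces. Traciality gives equality of the dimensions.
\<close>

section \<open>The Hilbert space of square-summable functions\<close>

text \<open>The potential of a square-summable gradient need not be square-summable, so only
  differences along edges are estimated. Being a gradient of a given function makes sense for every
  generating set, whereas the divergence depends on the graph; this is why the adjoint of the
  identity on functions is used, and not the identity itself.

  The resulting isomorphism need not be unitary, so it need not conjugate the two projections.
  Instead, if \<open>U\<close> and \<open>U'\<close> are mutually inverse, the two projections
  factor through \<open>U' U\<close> and \<open>U U'\<close>, and their traces add up one kernel on
  pairs of oriented edges in two ways. The kernel is invariant under the diagonal action, and the
  substitution of the inverse in the group exchanges the two sums.

  Every edge occurs in both orientations. The boundary of \<open>A\<close> is counted once, by
  orienting its edges outwards; a factor 2 appears only in inner products of antisymmetric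
  functions.\<close>

lemma l2_iff: "f \<in> l2 X \<longleftrightarrow> f \<in> l2 UNIV \<and> (\<forall>x. x \<notin> X \<longrightarrow> f x = 0)"
proof -
  have "(\<lambda>x. (cmod (f x))\<^sup>2) summable_on X \<longleftrightarrow> (\<lambda>x. (cmod (f x))\<^sup>2) summable_on UNIV"
    if "\<forall>x. x \<notin> X \<longrightarrow> f x = 0"
    by (rule summable_on_cong_neutral) (use that in auto)
  then show ?thesis
    unfolding l2_def by auto
qed

lemma l2_subset_UNIV: "f \<in> l2 X \<Longrightarrow> f \<in> l2 UNIV"
  using l2_iff by blast

lemma l2_norm_ge_0 [simp]: "0 \<le> l2_norm f"
  unfolding l2_norm_def by (simp add: infsum_nonneg)

lemma l2_norm_power2: "(l2_norm f)\<^sup>2 = (\<Sum>\<^sub>\<infinity>x. (cmod (f x))\<^sup>2)"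
  unfolding l2_norm_def by (simp add: infsum_nonneg)

lemma L2_set_le_l2_norm:
  assumes "f \<in> l2 UNIV" and "finite A"
  shows "L2_set (\<lambda>x. cmod (f x)) A \<le> l2_norm f"
proof -
  have "(\<Sum>x\<in>A. (cmod (f x))\<^sup>2) \<le> (\<Sum>\<^sub>\<infinity>x. (cmod (f x))\<^sup>2)"
    using assms by (intro finite_sum_le_infsum) (auto simp: l2_def)
  then show ?thesis
    unfolding L2_set_def l2_norm_def by simp
qed

text \<open>The norm is the supremum of the norms over finite sets, so inequalities known for
  \<open>L2_set\<close> carry over and yield membership at the same time.\<close>

lemma l2_bounded:
  assumes "\<And>A. finite A \<Longrightarrow> L2_set (\<lambda>x. cmod (f x)) A \<le> C"
  shows "f \<in> l2 UNIV" and "l2_norm f \<le> C"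
proof -
  have C: "0 \<le> C" using assms[of "{}"] by simp
  have *: "(\<Sum>x\<in>A. (cmod (f x))\<^sup>2) \<le> C\<^sup>2" if "finite A" for A
    using assms[OF that] C unfolding L2_set_def
    by (simp add: sum_nonneg real_sqrt_le_iff' sqrt_le_D)
  have s: "(\<lambda>x. (cmod (f x))\<^sup>2) summable_on UNIV"
    by (rule nonneg_bounded_partial_sums_imp_summable_on[where C = "C\<^sup>2"])
       (auto intro!: eventually_finite_subsets_at_top_weakI *)
  then show "f \<in> l2 UNIV" by (simp add: l2_def)
  have "(\<Sum>\<^sub>\<infinity>x. (cmod (f x))\<^sup>2) \<le> C\<^sup>2"
    by (rule infsum_le_finite_sums[OF s]) (use * in auto)
  then show "l2_norm f \<le> C"
    unfolding l2_norm_def using C by (simp add: real_le_lsqrt)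
qed

lemma l2_add:
  assumes "f \<in> l2 UNIV" and "g \<in> l2 UNIV"
  shows "(\<lambda>x. f x + g x) \<in> l2 UNIV" and "l2_norm (\<lambda>x. f x + g x) \<le> l2_norm f + l2_norm g"
proof -
  have "L2_set (\<lambda>x. cmod (f x + g x)) A \<le> l2_norm f + l2_norm g" if "finite A" for A
  proof -
    have "L2_set (\<lambda>x. cmod (f x + g x)) A \<le> L2_set (\<lambda>x. cmod (f x) + cmod (g x)) A"
      by (intro L2_set_mono norm_triangle_ineq) auto
    also have "\<dots> \<le> L2_set (\<lambda>x. cmod (f x)) A + L2_set (\<lambda>x. cmod (g x)) A"
      by (rule L2_set_triangle_ineq)
    also have "\<dots> \<le> l2_norm f + l2_norm g"
      using assms that by (intro add_mono L2_set_le_l2_norm)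
    finally show ?thesis .
  qed
  from l2_bounded[OF this]
  show "(\<lambda>x. f x + g x) \<in> l2 UNIV" and "l2_norm (\<lambda>x. f x + g x) \<le> l2_norm f + l2_norm g"
    by auto
qed

lemma l2_norm_scale: "l2_norm (\<lambda>x. a * f x) = cmod a * l2_norm f"
  unfolding l2_norm_def
  by (simp add: norm_mult power_mult_distrib infsum_cmult_right' real_sqrt_mult)

lemma l2_scale: "f \<in> l2 UNIV \<Longrightarrow> (\<lambda>x. a * f x) \<in> l2 UNIV"
  unfolding l2_def by (simp add: norm_mult power_mult_distrib summable_on_cmult_right)

lemma l2_lincomb: "f \<in> l2 UNIV \<Longrightarrow> g \<in> l2 UNIV \<Longrightarrow> (\<lambda>x. f x + a * g x) \<in> l2 UNIV"
  by (intro l2_add l2_scale)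

lemma l2_diff: "f \<in> l2 UNIV \<Longrightarrow> g \<in> l2 UNIV \<Longrightarrow> (\<lambda>x. f x - g x) \<in> l2 UNIV"
  using l2_lincomb[of f g "-1"] by simp

lemma l2_norm_diff_triangle:
  assumes "f \<in> l2 UNIV" and "g \<in> l2 UNIV" and "h \<in> l2 UNIV"
  shows "l2_norm (\<lambda>x. f x - h x) \<le> l2_norm (\<lambda>x. f x - g x) + l2_norm (\<lambda>x. g x - h x)"
  using l2_add(2)[OF l2_diff[OF assms(1,2)] l2_diff[OF assms(2,3)]] by simp

lemma l2_zero [simp]: "(\<lambda>x. 0) \<in> l2 X"
  by (simp add: l2_def)

lemma l2_norm_zero [simp]: "l2_norm (\<lambda>x. 0) = 0"
  by (simp add: l2_norm_def)

lemma l2_finite_support: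
  assumes "finite {x. f x \<noteq> 0}"
  shows "f \<in> l2 UNIV"
proof -
  have "(\<lambda>x. (cmod (f x))\<^sup>2) summable_on {x. f x \<noteq> 0}"
    using assms by simp
  then have "f \<in> l2 {x. f x \<noteq> 0}" by (simp add: l2_def)
  then show ?thesis by (rule l2_subset_UNIV)
qed

lemma indicator_in_l2 [simp]: "(indicator {x} :: 'i \<Rightarrow> complex) \<in> l2 UNIV"
  by (rule l2_finite_support) (rule finite_subset[of _ "{x}"], auto simp: indicator_def)

lemma cmod_le_l2_norm: "f \<in> l2 UNIV \<Longrightarrow> cmod (f x) \<le> l2_norm f"
  using L2_set_le_l2_norm[of f "{x}"] by simp

lemma l2_norm_eq_0D: "f \<in> l2 UNIV \<Longrightarrow> l2_norm f = 0 \<Longrightarrow> f x = 0"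
  using cmod_le_l2_norm[of f x] by simp

text \<open>A finite part of \<open>f\<close> is carried by \<open>\<phi>\<close> injectively to a
  finite part of \<open>g\<close>. The two index types may differ, so this also compares functions
  on vertices with functions on edges.\<close>

lemma l2_reindex:
  assumes g: "g \<in> l2 UNIV" and inj: "inj_on \<phi> {x. f x \<noteq> 0}"
    and f: "\<And>x. f x \<noteq> 0 \<Longrightarrow> cmod (f x) \<le> cmod (g (\<phi> x))"
  shows "f \<in> l2 UNIV" and "l2_norm f \<le> l2_norm g"
proof -
  have "L2_set (\<lambda>x. cmod (f x)) A \<le> l2_norm g" if A: "finite A" for A
  proof -
    let ?B = "A \<inter> {x. f x \<noteq> 0}"
    have "(\<Sum>x\<in>A. (cmod (f x))\<^sup>2) = (\<Sum>x\<in>?B. (cmod (f x))\<^sup>2)"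
      using A by (intro sum.mono_neutral_right) auto
    also have "\<dots> \<le> (\<Sum>x\<in>?B. (cmod (g (\<phi> x)))\<^sup>2)"
      using f by (intro sum_mono power_mono) auto
    also have "\<dots> = (\<Sum>y\<in>\<phi> ` ?B. (cmod (g y))\<^sup>2)"
      using inj by (subst sum.reindex) (auto intro: inj_on_subset)
    finally have "L2_set (\<lambda>x. cmod (f x)) A \<le> L2_set (\<lambda>x. cmod (g x)) (\<phi> ` ?B)"
      unfolding L2_set_def by simp
    also have "\<dots> \<le> l2_norm g"
      using g A by (intro L2_set_le_l2_norm) auto
    finally show ?thesis .
  qed
  from l2_bounded[OF this] show "f \<in> l2 UNIV" and "l2_norm f \<le> l2_norm g"
    by auto
qed

section \<open>The inner product\<close>

lemma l2_mult_abs_summable: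
  assumes f: "f \<in> l2 UNIV" and g: "g \<in> l2 UNIV"
  shows "(\<lambda>x. cmod (f x * cnj (g x))) summable_on UNIV"
    and "(\<Sum>\<^sub>\<infinity>x. cmod (f x * cnj (g x))) \<le> l2_norm f * l2_norm g"
proof -
  have *: "(\<Sum>x\<in>A. cmod (f x * cnj (g x))) \<le> l2_norm f * l2_norm g" if "finite A" for A
  proof -
    have "(\<Sum>x\<in>A. cmod (f x * cnj (g x))) = (\<Sum>x\<in>A. \<bar>cmod (f x)\<bar> * \<bar>cmod (g x)\<bar>)"
      by (simp add: norm_mult)
    also have "\<dots> \<le> L2_set (\<lambda>x. cmod (f x)) A * L2_set (\<lambda>x. cmod (g x)) A"
      by (rule L2_set_mult_ineq)
    also have "\<dots> \<le> l2_norm f * l2_norm g"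
      using f g that by (intro mult_mono L2_set_le_l2_norm) auto
    finally show ?thesis .
  qed
  show s: "(\<lambda>x. cmod (f x * cnj (g x))) summable_on UNIV"
    by (rule nonneg_bounded_partial_sums_imp_summable_on[where C = "l2_norm f * l2_norm g"])
       (auto intro!: eventually_finite_subsets_at_top_weakI *)
  show "(\<Sum>\<^sub>\<infinity>x. cmod (f x * cnj (g x))) \<le> l2_norm f * l2_norm g"
    by (rule infsum_le_finite_sums[OF s]) (use * in auto)
qed

lemma l2_mult_summable:
  "f \<in> l2 UNIV \<Longrightarrow> g \<in> l2 UNIV \<Longrightarrow> (\<lambda>x. f x * cnj (g x)) summable_on UNIV"
  by (rule abs_summable_summable) (rule l2_mult_abs_summable)

lemma l2_Cauchy_Schwarz:
  assumes "f \<in> l2 UNIV" and "g \<in> l2 UNIV"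
  shows "cmod (l2_inner f g) \<le> l2_norm f * l2_norm g"
  unfolding l2_inner_def
  using norm_infsum_bound[OF l2_mult_abs_summable(1)[OF assms]] l2_mult_abs_summable(2)[OF assms]
  by linarith

lemma l2_inner_lincomb_left:
  assumes "f \<in> l2 UNIV" and "g \<in> l2 UNIV" and "h \<in> l2 UNIV"
  shows "l2_inner (\<lambda>x. f x + a * g x) h = l2_inner f h + a * l2_inner g h"
  unfolding l2_inner_def
  using l2_mult_summable[OF assms(1,3)] l2_mult_summable[OF assms(2,3)]
  by (simp add: ring_distribs mult.assoc infsum_add summable_on_cmult_right infsum_cmult_right')

lemma l2_inner_commute: "l2_inner g f = cnj (l2_inner f g)"
proof -
  have "cnj (l2_inner f g) = (\<Sum>\<^sub>\<infinity>x. cnj (f x * cnj (g x)))"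
    unfolding l2_inner_def by (rule infsum_cnj[symmetric])
  then show ?thesis by (simp add: l2_inner_def mult.commute)
qed

lemma l2_inner_lincomb_right:
  assumes "f \<in> l2 UNIV" and "g \<in> l2 UNIV" and "h \<in> l2 UNIV"
  shows "l2_inner h (\<lambda>x. f x + a * g x) = l2_inner h f + cnj a * l2_inner h g"
  using l2_inner_lincomb_left[OF assms, of a] l2_inner_commute
  by (metis complex_cnj_add complex_cnj_mult)

lemma l2_inner_diff_left:
  assumes "f \<in> l2 UNIV" and "g \<in> l2 UNIV" and "h \<in> l2 UNIV"
  shows "l2_inner (\<lambda>x. f x - g x) h = l2_inner f h - l2_inner g h"
  using l2_inner_lincomb_left[OF assms, of "-1"] by simp

lemma l2_inner_diff_right:
  assumes "f \<in> l2 UNIV" and "g \<in> l2 UNIV" and "h \<in> l2 UNIV"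
  shows "l2_inner h (\<lambda>x. f x - g x) = l2_inner h f - l2_inner h g"
  using l2_inner_lincomb_right[OF assms, of "-1"] by simp

lemma l2_inner_zero_left [simp]: "l2_inner (\<lambda>x. 0) f = 0"
  and l2_inner_zero_right [simp]: "l2_inner f (\<lambda>x. 0) = 0"
  by (simp_all add: l2_inner_def)

lemma l2_inner_scale_left: "l2_inner (\<lambda>x. a * f x) g = a * l2_inner f g"
  unfolding l2_inner_def by (simp add: mult.assoc infsum_cmult_right')

lemma l2_inner_self: "l2_inner f f = complex_of_real ((l2_norm f)\<^sup>2)"
proof -
  have "l2_inner f f = (\<Sum>\<^sub>\<infinity>x. complex_of_real ((cmod (f x))\<^sup>2))"
    unfolding l2_inner_def by (simp add: complex_norm_square del: of_real_power)
  also have "\<dots> = complex_of_real (\<Sum>\<^sub>\<infinity>x. (cmod (f x))\<^sup>2)"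
  proof (cases "(\<lambda>x. (cmod (f x))\<^sup>2) summable_on UNIV")
    case True
    then show ?thesis by (intro infsumI has_sum_of_real has_sum_infsum)
  next
    case False
    \<comment> \<open>Both infinite sums take the default value 0 in this case, so the identity
      holds for every \<open>f\<close>.\<close>
    then have F: "\<not> (\<lambda>x. complex_of_real ((cmod (f x))\<^sup>2)) summable_on UNIV"
      using summable_on_Re[of "\<lambda>x. complex_of_real ((cmod (f x))\<^sup>2)" UNIV]
      by (simp only: Re_complex_of_real) blast
    show ?thesis unfolding infsum_not_exists[OF False] infsum_not_exists[OF F] by simp
  qed
  finally show ?thesis by (simp add: l2_norm_power2)
qed

lemma l2_inner_self_eq_0D:
  "f \<in> l2 UNIV \<Longrightarrow> l2_inner f f = 0 \<Longrightarrow> f x = 0"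
  using l2_norm_eq_0D[of f x] by (simp add: l2_inner_self)

lemma l2_inner_finite:
  assumes "finite A" and "\<And>x. x \<notin> A \<Longrightarrow> f x * cnj (g x) = 0"
  shows "l2_inner f g = (\<Sum>x\<in>A. f x * cnj (g x))"
proof -
  have "l2_inner f g = (\<Sum>\<^sub>\<infinity>x\<in>A. f x * cnj (g x))"
    unfolding l2_inner_def by (rule infsum_cong_neutral) (use assms(2) in auto)
  then show ?thesis using assms(1) by simp
qed

lemma l2_inner_indicator [simp]: "l2_inner f (indicator {x}) = f x"
  by (subst l2_inner_finite[of "{x}"]) (auto simp: indicator_def)

text \<open>The values 1 and -1 of \<open>a\<close> give the parallelogram law; a small multiple of
  \<open>l2_inner f g\<close> gives the first variation of the distance.\<close>

lemma l2_norm_diff_lincomb_power2: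
  assumes f: "f \<in> l2 UNIV" and g: "g \<in> l2 UNIV"
  shows "(l2_norm (\<lambda>x. f x - a * g x))\<^sup>2 =
    (l2_norm f)\<^sup>2 - 2 * Re (cnj a * l2_inner f g) + (cmod a)\<^sup>2 * (l2_norm g)\<^sup>2"
proof -
  let ?h = "\<lambda>x. f x + (- a) * g x"
  have h: "?h \<in> l2 UNIV" by (intro l2_lincomb f g)
  have "l2_inner ?h ?h = l2_inner f ?h - a * l2_inner g ?h"
    using l2_inner_lincomb_left[OF f g h, of "-a"] by simp
  also have "\<dots> = l2_inner f f - cnj a * l2_inner f g - a * (l2_inner g f - cnj a * l2_inner g g)"
    using l2_inner_lincomb_right[OF f g f, of "-a"] l2_inner_lincomb_right[OF f g g, of "-a"] by simp
  also have "\<dots> = l2_inner f f - (cnj a * l2_inner f g + cnj (cnj a * l2_inner f g))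
      + (a * cnj a) * l2_inner g g"
    by (simp add: l2_inner_commute[of g f] algebra_simps)
  also have "\<dots> = complex_of_real ((l2_norm f)\<^sup>2 - 2 * Re (cnj a * l2_inner f g)
      + (cmod a)\<^sup>2 * (l2_norm g)\<^sup>2)"
    by (simp only: complex_add_cnj l2_inner_self complex_norm_square[symmetric] of_real_add
        of_real_diff of_real_mult)
  finally show ?thesis
    by (simp only: l2_inner_self of_real_eq_iff) simp
qed

lemma l2_parallelogram:
  assumes "f \<in> l2 UNIV" and "g \<in> l2 UNIV"
  shows "(l2_norm (\<lambda>x. f x - g x))\<^sup>2 + (l2_norm (\<lambda>x. f x + g x))\<^sup>2 = 2 * (l2_norm f)\<^sup>2 + 2 * (l2_norm g)\<^sup>2"
  using l2_norm_diff_lincomb_power2[OF assms, of 1] l2_norm_diff_lincomb_power2[OF assms, of "-1"]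
  by simp

section \<open>Closed subspaces and orthogonal projections\<close>

definition closed_subspace :: "('i \<Rightarrow> complex) set \<Rightarrow> bool" where
  "closed_subspace V \<longleftrightarrow> V \<subseteq> l2 UNIV \<and> (\<lambda>_. 0) \<in> V \<and>
    (\<forall>f\<in>V. \<forall>g\<in>V. \<forall>a. (\<lambda>x. f x + a * g x) \<in> V) \<and> l2_closure UNIV V \<subseteq> V"

lemma closed_subspaceD:
  assumes "closed_subspace V"
  shows "f \<in> V \<Longrightarrow> f \<in> l2 UNIV" and "(\<lambda>_. 0) \<in> V"
    and "f \<in> V \<Longrightarrow> g \<in> V \<Longrightarrow> (\<lambda>x. f x + a * g x) \<in> V"
    and "f \<in> V \<Longrightarrow> (\<lambda>x. a * f x) \<in> V"
    and "f \<in> V \<Longrightarrow> g \<in> V \<Longrightarrow> (\<lambda>x. f x + g x) \<in> V"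
    and "f \<in> V \<Longrightarrow> g \<in> V \<Longrightarrow> (\<lambda>x. f x - g x) \<in> V"
    and "f \<in> l2 UNIV \<Longrightarrow> (\<And>e. e > 0 \<Longrightarrow> \<exists>v\<in>V. l2_norm (\<lambda>x. f x - v x) < e) \<Longrightarrow> f \<in> V"
proof -
  note V = assms[unfolded closed_subspace_def]
  show "f \<in> V \<Longrightarrow> f \<in> l2 UNIV" and 0: "(\<lambda>_. 0) \<in> V" using V by auto
  show lin: "f \<in> V \<Longrightarrow> g \<in> V \<Longrightarrow> (\<lambda>x. f x + a * g x) \<in> V" for f g a using V by blast
  show "f \<in> V \<Longrightarrow> (\<lambda>x. a * f x) \<in> V" using lin[OF 0, of f a] by simp
  show "f \<in> V \<Longrightarrow> g \<in> V \<Longrightarrow> (\<lambda>x. f x + g x) \<in> V" using lin[of f g 1] by simp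
  show "f \<in> V \<Longrightarrow> g \<in> V \<Longrightarrow> (\<lambda>x. f x - g x) \<in> V" using lin[of f g "-1"] by simp
  show "f \<in> l2 UNIV \<Longrightarrow> (\<And>e. e > 0 \<Longrightarrow> \<exists>v\<in>V. l2_norm (\<lambda>x. f x - v x) < e) \<Longrightarrow> f \<in> V"
    using V unfolding l2_closure_def by blast
qed

lemma closed_subspaceI:
  assumes "\<And>f. f \<in> V \<Longrightarrow> f \<in> l2 UNIV" and "(\<lambda>_. 0) \<in> V"
    and "\<And>f g a. f \<in> V \<Longrightarrow> g \<in> V \<Longrightarrow> (\<lambda>x. f x + a * g x) \<in> V"
    and "\<And>f. f \<in> l2 UNIV \<Longrightarrow> (\<And>e. e > 0 \<Longrightarrow> \<exists>v\<in>V. l2_norm (\<lambda>x. f x - v x) < e) \<Longrightarrow> f \<in> V"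
  shows "closed_subspace V"
  using assms unfolding closed_subspace_def l2_closure_def by blast

text \<open>Completeness. Coordinates are bounded by the norm, so a pointwise limit exists; the
  estimate over each finite set passes to the limit, which places it in l2 and keeps the rate
  \<open>r\<close>.\<close>

lemma l2_Cauchy_limit:
  assumes v: "\<And>n. v n \<in> l2 UNIV"
    and C: "\<And>m n. n \<le> m \<Longrightarrow> l2_norm (\<lambda>x. v n x - v m x) \<le> r n"
    and r: "r \<longlonglongrightarrow> 0"
  obtains p where "p \<in> l2 UNIV" and "\<And>n. l2_norm (\<lambda>x. v n x - p x) \<le> r n"
proof -
  have "Cauchy (\<lambda>n. v n x)" for x
  proof (rule CauchyI')
    fix e :: real assume "e > 0"
    then obtain N where N: "r n < e" if "n \<ge> N" for n
      using order_tendstoD(2)[OF r] unfolding eventually_sequentially by blast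
    have "cmod (v m x - v n x) < e" if "m \<ge> N" and "n > m" for m n
    proof -
      have "cmod (v m x - v n x) \<le> l2_norm (\<lambda>x. v m x - v n x)"
        by (rule cmod_le_l2_norm[OF l2_diff[OF v v]])
      also have "\<dots> \<le> r m" using C that by simp
      finally show ?thesis using N[OF that(1)] by simp
    qed
    then show "\<exists>M. \<forall>m\<ge>M. \<forall>n>m. dist (v m x) (v n x) < e" unfolding dist_norm by (intro exI[of _ N]) auto
  qed
  then have "\<exists>l. (\<lambda>n. v n x) \<longlonglongrightarrow> l" for x
    by (simp add: Cauchy_convergent_iff convergent_def)
  then obtain p where p: "\<And>x. (\<lambda>n. v n x) \<longlonglongrightarrow> p x"
    by metis
  have *: "L2_set (\<lambda>x. cmod (v n x - p x)) A \<le> r n" if "finite A" for n A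
  proof (rule LIMSEQ_le_const2)
    show "(\<lambda>m. L2_set (\<lambda>x. cmod (v n x - v m x)) A) \<longlonglongrightarrow> L2_set (\<lambda>x. cmod (v n x - p x)) A"
      unfolding L2_set_def by (intro tendsto_intros p)
    have "L2_set (\<lambda>x. cmod (v n x - v m x)) A \<le> r n" if "n \<le> m" for m
      using L2_set_le_l2_norm[OF l2_diff[OF v v] \<open>finite A\<close>, of n m] C[OF that] by linarith
    then show "\<exists>N. \<forall>m\<ge>N. L2_set (\<lambda>x. cmod (v n x - v m x)) A \<le> r n" by blast
  qed
  have "(\<lambda>x. v n x - p x) \<in> l2 UNIV" and n: "l2_norm (\<lambda>x. v n x - p x) \<le> r n" for n
    using l2_bounded[OF *] by auto
  from l2_diff[OF v[of 0] this(1)[of 0]] have "p \<in> l2 UNIV" by simp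
  then show thesis using n by (rule that)
qed

lemma orthogonal_if_minimal:
  assumes f: "f \<in> l2 UNIV" and v: "v \<in> l2 UNIV"
    and min: "\<And>a. l2_norm f \<le> l2_norm (\<lambda>x. f x - a * v x)"
  shows "l2_inner f v = 0"
proof (rule ccontr)
  define z where "z = l2_inner f v"
  define N where "N = (l2_norm v)\<^sup>2"
  \<comment> \<open>Subtracting \<open>t * z\<close> times \<open>v\<close> changes the squared norm
    by \<open>t * (cmod z)\<^sup>2 * (t * N - 2)\<close>, negative as soon as
    \<open>t * N < 2\<close>. The summand 1 keeps the denominator positive.\<close>
  define t where "t = 1 / (N + 1)"
  assume "l2_inner f v \<noteq> 0"
  then have z: "(cmod z)\<^sup>2 > 0" by (simp add: z_def)
  have N: "N \<ge> 0" by (simp add: N_def)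
  then have t: "t > 0" "t * N < 1" by (simp_all add: t_def field_simps)
  have "(l2_norm f)\<^sup>2 \<le> (l2_norm (\<lambda>x. f x - (of_real t * z) * v x))\<^sup>2"
    using min by (intro power_mono) auto
  also have "\<dots> = (l2_norm f)\<^sup>2 - 2 * Re (cnj (of_real t * z) * z) + (cmod (of_real t * z))\<^sup>2 * N"
    unfolding z_def N_def by (rule l2_norm_diff_lincomb_power2[OF f v])
  also have "Re (cnj (of_real t * z) * z) = t * (cmod z)\<^sup>2"
  proof -
    have "cnj (of_real t * z) * z = of_real t * (z * cnj z)" by simp
    also have "\<dots> = of_real (t * (cmod z)\<^sup>2)" by (simp only: complex_norm_square[symmetric] of_real_mult)
    finally show ?thesis by (simp only: Re_complex_of_real)
  qed
  also have "(cmod (of_real t * z))\<^sup>2 = t\<^sup>2 * (cmod z)\<^sup>2"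
    by (simp add: norm_mult power_mult_distrib)
  finally have "0 \<le> t * (cmod z)\<^sup>2 * (t * N - 2)"
    by (simp add: power2_eq_square algebra_simps)
  moreover have "t * (cmod z)\<^sup>2 * (t * N - 2) < 0"
    using z t by (intro mult_pos_neg mult_pos_pos) auto
  ultimately show False by simp
qed

lemma projection_exists:
  assumes V: "closed_subspace V" and f: "f \<in> l2 UNIV"
  obtains p where "p \<in> V" and "\<And>v. v \<in> V \<Longrightarrow> l2_inner (\<lambda>x. f x - p x) v = 0"
proof -
  define D where "D v = (l2_norm (\<lambda>x. f x - v x))\<^sup>2" for v
  define \<delta> where "\<delta> = (INF v\<in>V. D v)"
  note Vl2 = closed_subspaceD(1)[OF V]
  have bdd: "bdd_below (D ` V)" by (rule bdd_belowI[of _ 0]) (auto simp: D_def)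
  have low: "\<delta> \<le> D v" if "v \<in> V" for v
    unfolding \<delta>_def using bdd that by (rule cINF_lower)
  have "\<exists>v\<in>V. D v < \<delta> + inverse (real (Suc n))" for n
    using cINF_less_iff[OF _ bdd, of "\<delta> + inverse (real (Suc n))"] closed_subspaceD(2)[OF V]
    unfolding \<delta>_def by auto
  then obtain v where v: "v n \<in> V" and vD: "D (v n) < \<delta> + inverse (real (Suc n))" for n
    by metis
  \<comment> \<open>The midpoint of \<open>v n\<close> and \<open>v m\<close> lies in
    \<open>V\<close>, at squared distance at least \<open>\<delta>\<close> from \<open>f\<close>.
    The parallelogram law then bounds the squared norm of \<open>v n - v m\<close> by 2/(n+1) +
    2/(m+1), hence by 4/(n+1) for \<open>n \<le> m\<close>.\<close>
  define r where "r n = sqrt (4 * inverse (real (Suc n)))" for n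
  have r0: "r \<longlonglongrightarrow> 0"
    using tendsto_real_sqrt[OF tendsto_mult[OF tendsto_const LIMSEQ_inverse_real_of_nat], of 4]
    by (simp add: r_def[abs_def])
  have cau: "l2_norm (\<lambda>x. v n x - v m x) \<le> r n" if nm: "n \<le> m" for n m
  proof -
    let ?a = "\<lambda>x. f x - v n x" and ?b = "\<lambda>x. f x - v m x"
    let ?w = "\<lambda>x. (1/2) * (v n x + v m x)"
    have w: "?w \<in> V"
      by (intro closed_subspaceD(4)[OF V] closed_subspaceD(5)[OF V] v)
    have ab: "?a \<in> l2 UNIV" "?b \<in> l2 UNIV" using f v Vl2 by (auto intro!: l2_diff)
    have "(\<lambda>x. ?a x + ?b x) = (\<lambda>x. 2 * (f x - ?w x))" by (auto simp: algebra_simps)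
    then have "l2_norm (\<lambda>x. ?a x + ?b x) = 2 * l2_norm (\<lambda>x. f x - ?w x)"
      using l2_norm_scale[of 2 "\<lambda>x. f x - ?w x"] by (simp only:) simp
    then have "(l2_norm (\<lambda>x. ?a x + ?b x))\<^sup>2 = 4 * D ?w"
      by (simp only: power_mult_distrib D_def) simp
    moreover have "l2_norm (\<lambda>x. ?a x - ?b x) = l2_norm (\<lambda>x. v n x - v m x)"
      using l2_norm_scale[of "-1" "\<lambda>x. v n x - v m x"] by simp
    ultimately have "(l2_norm (\<lambda>x. v n x - v m x))\<^sup>2 + 4 * D ?w = 2 * D (v n) + 2 * D (v m)"
      using l2_parallelogram[OF ab] by (simp add: D_def)
    moreover have "inverse (real (Suc m)) \<le> inverse (real (Suc n))"
      using nm by simp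
    ultimately have "(l2_norm (\<lambda>x. v n x - v m x))\<^sup>2 \<le> 4 * inverse (real (Suc n))"
      using low[OF w] vD[of n] vD[of m] by linarith
    then show ?thesis unfolding r_def by (rule real_le_rsqrt)
  qed
  obtain p where p: "p \<in> l2 UNIV" and pr: "\<And>n. l2_norm (\<lambda>x. v n x - p x) \<le> r n"
    using l2_Cauchy_limit[of v r] cau r0 Vl2 v by metis
  have pV: "p \<in> V"
  proof (rule closed_subspaceD(7)[OF V p])
    fix e :: real assume "e > 0"
    then obtain n where "r n < e"
      using order_tendstoD(2)[OF r0] unfolding eventually_sequentially by blast
    moreover have "l2_norm (\<lambda>x. p x - v n x) = l2_norm (\<lambda>x. v n x - p x)"
      using l2_norm_scale[of "-1" "\<lambda>x. v n x - p x"] by simp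
    ultimately show "\<exists>v\<in>V. l2_norm (\<lambda>x. p x - v x) < e"
      using pr[of n] by (intro bexI[OF _ v[of n]]) linarith
  qed
  have pmin: "l2_norm (\<lambda>x. f x - p x) \<le> sqrt \<delta>"
  proof (rule LIMSEQ_le_const)
    show "(\<lambda>n. sqrt (\<delta> + inverse (real (Suc n))) + r n) \<longlonglongrightarrow> sqrt \<delta>"
      using tendsto_add[OF tendsto_real_sqrt[OF tendsto_add[OF tendsto_const LIMSEQ_inverse_real_of_nat]] r0, of \<delta>]
      by simp
    have "l2_norm (\<lambda>x. f x - p x) \<le> sqrt (\<delta> + inverse (real (Suc n))) + r n" for n
    proof -
      have "l2_norm (\<lambda>x. f x - v n x) \<le> sqrt (\<delta> + inverse (real (Suc n)))"
        using vD[of n] unfolding D_def by (intro real_le_rsqrt) simp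
      then show ?thesis
        using l2_norm_diff_triangle[OF f Vl2[OF v] p, of n] pr[of n] by linarith
    qed
    then show "\<exists>N. \<forall>n\<ge>N. l2_norm (\<lambda>x. f x - p x) \<le> sqrt (\<delta> + inverse (real (Suc n))) + r n"
      by blast
  qed
  have "l2_inner (\<lambda>x. f x - p x) u = 0" if u: "u \<in> V" for u
  proof (rule orthogonal_if_minimal[OF l2_diff[OF f p] Vl2[OF u]])
    fix a
    have "sqrt \<delta> \<le> l2_norm (\<lambda>x. f x - (p x + a * u x))"
      using low[OF closed_subspaceD(3)[OF V pV u]] unfolding D_def
      by (rule real_le_lsqrt[rotated]) simp
    then show "l2_norm (\<lambda>x. f x - p x) \<le> l2_norm (\<lambda>x. f x - p x - a * u x)"
      using pmin by (simp add: diff_diff_eq)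
  qed
  then show thesis using pV that by blast
qed

lemma orth_proj_eqI:
  assumes V: "closed_subspace V" and f: "f \<in> l2 UNIV"
    and p: "p \<in> V" and orth: "\<And>v. v \<in> V \<Longrightarrow> l2_inner (\<lambda>x. f x - p x) v = 0"
  shows "orth_proj V f = p"
  unfolding orth_proj_def
proof (rule the_equality)
  show "p \<in> V \<and> (\<forall>v\<in>V. l2_inner (\<lambda>x. f x - p x) v = 0)" using p orth by blast
next
  fix q assume q: "q \<in> V \<and> (\<forall>v\<in>V. l2_inner (\<lambda>x. f x - q x) v = 0)"
  let ?d = "\<lambda>x. q x - p x"
  note Vl2 = closed_subspaceD(1)[OF V]
  have d: "?d \<in> V" using p q closed_subspaceD(6)[OF V] by blast
  have "l2_inner (\<lambda>x. (f x - p x) - (f x - q x)) ?d = 0"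
    using l2_inner_diff_left[OF l2_diff[OF f Vl2] l2_diff[OF f Vl2] Vl2[OF d], of p q] p q orth d by simp
  then have "l2_inner ?d ?d = 0" by simp
  from l2_inner_self_eq_0D[OF Vl2[OF d] this] show "q = p" by auto
qed

lemma orth_proj:
  assumes V: "closed_subspace V" and f: "f \<in> l2 UNIV"
  shows "orth_proj V f \<in> V" and "v \<in> V \<Longrightarrow> l2_inner (\<lambda>x. f x - orth_proj V f x) v = 0"
    and "v \<in> V \<Longrightarrow> l2_inner (orth_proj V f) v = l2_inner f v"
    and "v \<in> V \<Longrightarrow> l2_inner v (orth_proj V f) = l2_inner v f"
proof -
  obtain p where p: "p \<in> V" "\<And>v. v \<in> V \<Longrightarrow> l2_inner (\<lambda>x. f x - p x) v = 0"
    using projection_exists[OF assms] by blast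
  have eq: "orth_proj V f = p" by (rule orth_proj_eqI[OF assms p])
  show 1: "orth_proj V f \<in> V" and 2: "v \<in> V \<Longrightarrow> l2_inner (\<lambda>x. f x - orth_proj V f x) v = 0" for v
    using p eq by auto
  show 3: "v \<in> V \<Longrightarrow> l2_inner (orth_proj V f) v = l2_inner f v" for v
    using 2[of v] l2_inner_diff_left[OF f] closed_subspaceD(1)[OF V] 1 by simp
  show "v \<in> V \<Longrightarrow> l2_inner v (orth_proj V f) = l2_inner v f"
    using 3[of v] l2_inner_commute by metis
qed

lemma l2_inner_closed:
  assumes f: "f \<in> l2 UNIV" and v: "v \<in> l2 UNIV" and U: "U \<subseteq> l2 UNIV"
    and cl: "\<And>e. e > 0 \<Longrightarrow> \<exists>u\<in>U. l2_norm (\<lambda>x. f x - u x) < e"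
    and 0: "\<And>u. u \<in> U \<Longrightarrow> l2_inner u v = 0"
  shows "l2_inner f v = 0"
proof (rule ccontr)
  assume ne: "l2_inner f v \<noteq> 0"
  \<comment> \<open>With this \<open>e\<close>, Cauchy-Schwarz bounds the modulus of the inner
    product strictly below itself.\<close>
  define e where "e = cmod (l2_inner f v) / (l2_norm v + 1)"
  have n: "l2_norm v + 1 > 0" using l2_norm_ge_0[of v] by linarith
  then have "e > 0" using ne by (simp add: e_def)
  then obtain u where u: "u \<in> U" "l2_norm (\<lambda>x. f x - u x) < e" using cl by blast
  have ul: "u \<in> l2 UNIV" using u U by blast
  have "cmod (l2_inner f v) = cmod (l2_inner (\<lambda>x. f x - u x) v)"
    using l2_inner_diff_left[OF f ul v] 0[OF u(1)] by simp
  also have "\<dots> \<le> l2_norm (\<lambda>x. f x - u x) * l2_norm v"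
    by (rule l2_Cauchy_Schwarz[OF l2_diff[OF f ul] v])
  also have "\<dots> \<le> e * l2_norm v"
    using u by (intro mult_right_mono) auto
  also have "\<dots> < e * (l2_norm v + 1)" using \<open>e > 0\<close> by simp
  also have "\<dots> = cmod (l2_inner f v)" using n by (simp add: e_def)
  finally show False by simp
qed

text \<open>Closed and harmonic forms are shown to be closed subspaces through this lemma, each
  linear condition being written as orthogonality to a vector.\<close>

lemma closed_subspace_orthogonal:
  assumes V: "closed_subspace V" and U: "U \<subseteq> l2 UNIV"
  shows "closed_subspace {f \<in> V. \<forall>u\<in>U. l2_inner f u = 0}" (is "closed_subspace ?W")
proof (rule closed_subspaceI)
  note Vl2 = closed_subspaceD(1)[OF V]
  show "f \<in> ?W \<Longrightarrow> f \<in> l2 UNIV" for f using Vl2 by auto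
  show "(\<lambda>_. 0) \<in> ?W" using closed_subspaceD(2)[OF V] by simp
  show "(\<lambda>x. f x + a * g x) \<in> ?W" if "f \<in> ?W" "g \<in> ?W" for f g a
  proof -
    have "l2_inner (\<lambda>x. f x + a * g x) u = 0" if "u \<in> U" for u
      using l2_inner_lincomb_left[of f g u a] that \<open>f \<in> ?W\<close> \<open>g \<in> ?W\<close> Vl2 U by auto
    then show ?thesis using that closed_subspaceD(3)[OF V, of f g a] by auto
  qed
  show "f \<in> ?W" if f: "f \<in> l2 UNIV" and cl: "\<And>e. e > 0 \<Longrightarrow> \<exists>v\<in>?W. l2_norm (\<lambda>x. f x - v x) < e" for f
  proof -
    have "f \<in> V" using cl by (intro closed_subspaceD(7)[OF V f]) blast
    moreover have "l2_inner f u = 0" if "u \<in> U" for u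
      by (rule l2_inner_closed[OF f _ _ cl]) (use that U Vl2 in auto)
    ultimately show ?thesis by blast
  qed
qed

lemma closed_subspace_UNIV: "closed_subspace (l2 UNIV)"
  by (rule closed_subspaceI) (auto intro: l2_lincomb)

text \<open>The kernel of \<open>\<phi>\<close> is closed, and a vector of \<open>V\<close>
  orthogonal to it represents \<open>\<phi>\<close> up to a scalar. It serves twice: for point
  evaluations, which give matrix coefficients, and for the construction of
  \<open>transfer\<close>.\<close>

lemma Riesz_representation:
  assumes V: "closed_subspace V"
    and lin: "\<And>f g a. f \<in> V \<Longrightarrow> g \<in> V \<Longrightarrow> \<phi> (\<lambda>x. f x + a * g x) = \<phi> f + a * \<phi> g"
    and bdd: "\<And>f. f \<in> V \<Longrightarrow> cmod (\<phi> f) \<le> C * l2_norm f"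
  obtains c where "c \<in> V" and "\<And>f. f \<in> V \<Longrightarrow> \<phi> f = l2_inner f c"
proof -
  note Vl2 = closed_subspaceD(1)[OF V]
  define N where "N = {f \<in> V. \<phi> f = 0}"
  have diff: "\<phi> (\<lambda>x. f x - g x) = \<phi> f - \<phi> g" if "f \<in> V" "g \<in> V" for f g
    using lin[OF that, of "-1"] by simp
  have "closed_subspace N"
  proof (rule closed_subspaceI)
    show "f \<in> N \<Longrightarrow> f \<in> l2 UNIV" for f using Vl2 by (auto simp: N_def)
    show "(\<lambda>_. 0) \<in> N"
      using closed_subspaceD(2)[OF V] bdd[of "\<lambda>_. 0"] by (auto simp: N_def)
    show "(\<lambda>x. f x + a * g x) \<in> N" if "f \<in> N" "g \<in> N" for f g a
      using that closed_subspaceD(3)[OF V] lin by (auto simp: N_def)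
    show "f \<in> N" if f: "f \<in> l2 UNIV" and cl: "\<And>e. e > 0 \<Longrightarrow> \<exists>v\<in>N. l2_norm (\<lambda>x. f x - v x) < e" for f
    proof -
      have fV: "f \<in> V" using cl by (intro closed_subspaceD(7)[OF V f]) (auto simp: N_def)
      have "cmod (\<phi> f) \<le> 0 + e" if e: "e > 0" for e
      proof -
        have C1: "\<bar>C\<bar> + 1 > 0" by linarith
        obtain v where v: "v \<in> N" "l2_norm (\<lambda>x. f x - v x) < e / (\<bar>C\<bar> + 1)"
          using cl[of "e / (\<bar>C\<bar> + 1)"] divide_pos_pos[OF e C1] by blast
        have vV: "v \<in> V" using v by (simp add: N_def)
        have "cmod (\<phi> f) = cmod (\<phi> (\<lambda>x. f x - v x))"
          using diff[OF fV vV] v by (simp add: N_def)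
        also have "\<dots> \<le> C * l2_norm (\<lambda>x. f x - v x)"
          by (intro bdd closed_subspaceD(6)[OF V] fV vV)
        also have "\<dots> \<le> (\<bar>C\<bar> + 1) * l2_norm (\<lambda>x. f x - v x)"
          by (intro mult_right_mono) auto
        also have "\<dots> \<le> (\<bar>C\<bar> + 1) * (e / (\<bar>C\<bar> + 1))"
          using v C1 by (intro mult_left_mono) auto
        also have "\<dots> = e" using C1 by simp
        finally show ?thesis by simp
      qed
      then have "cmod (\<phi> f) \<le> 0" by (rule field_le_epsilon)
      then show ?thesis using fV by (simp add: N_def)
    qed
  qed
  note N = this
  show thesis
  proof (cases "N = V")
    case True
    then have "\<phi> f = l2_inner f (\<lambda>_. 0)" if "f \<in> V" for f
      using that by (auto simp: N_def)
    then show thesis using that closed_subspaceD(2)[OF V] by blast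
  next
    case False
    then obtain f0 where f0: "f0 \<in> V" "f0 \<notin> N" by (auto simp: N_def)
    define e where "e = (\<lambda>x. f0 x - orth_proj N f0 x)"
    note P = orth_proj[OF N Vl2[OF f0(1)]]
    have eV: "e \<in> V" and eN: "\<phi> e = \<phi> f0"
      unfolding e_def using P(1) f0 diff closed_subspaceD(6)[OF V] by (auto simp: N_def)
    have \<phi>e: "\<phi> e \<noteq> 0" using eN f0 by (simp add: N_def)
    have orth: "l2_inner v e = 0" if "v \<in> N" for v
      using P(2)[OF that] l2_inner_commute[of v e] by (simp add: e_def)
    have "l2_norm e \<noteq> 0"
      using bdd[OF eV] \<phi>e by auto
    then have ne: "l2_inner e e \<noteq> 0" by (simp add: l2_inner_self)
    \<comment> \<open>The scalar is the one for which \<open>l2_inner e c = \<phi> e\<close>; it is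
      conjugated because the second argument of \<open>l2_inner\<close> is conjugate-linear.\<close>
    define c where "c = (\<lambda>x. cnj (\<phi> e / l2_inner e e) * e x)"
    have "\<phi> f = l2_inner f c" if f: "f \<in> V" for f
    proof -
      let ?g = "\<lambda>x. f x + (- (\<phi> f / \<phi> e)) * e x"
      have "?g \<in> N"
        using lin[OF f eV, of "- (\<phi> f / \<phi> e)"] closed_subspaceD(3)[OF V f eV, of "- (\<phi> f / \<phi> e)"] \<phi>e
        by (simp add: N_def)
      from orth[OF this] have "l2_inner f e = (\<phi> f / \<phi> e) * l2_inner e e"
        using l2_inner_lincomb_left[OF Vl2[OF f] Vl2[OF eV] Vl2[OF eV], of "- (\<phi> f / \<phi> e)"] by simp
      moreover have "l2_inner f c = (\<phi> e / l2_inner e e) * l2_inner f e"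
        unfolding c_def
        using l2_inner_commute[of f] l2_inner_scale_left[of _ e f]
        by (metis complex_cnj_cnj complex_cnj_mult)
      ultimately show ?thesis using ne \<phi>e by simp
    qed
    moreover have "c \<in> V" unfolding c_def by (rule closed_subspaceD(4)[OF V eV])
    ultimately show thesis using that by blast
  qed
qed

text \<open>
  The constraint \<open>v b = 0\<close> cuts out of \<open>V\<close> the line spanned by the projection of the basis vector at \<open>b\<close>,
  so it subtracts from the projection onto \<open>V\<close> one of rank at most one.
\<close>

lemma sum_orth_proj_diagonal_le_card:
  assumes "finite B" and "finite A" and "closed_subspace V"
    and "\<And>v x. v \<in> V \<Longrightarrow> (\<And>b. b \<in> B \<Longrightarrow> v b = 0) \<Longrightarrow> x \<in> A \<Longrightarrow> v x = 0"
  shows "(\<Sum>x\<in>A. Re (orth_proj V (indicator {x}) x)) \<le> real (card B)"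
  using assms(1,3,4)
proof (induction B arbitrary: V rule: finite_induct)
  case empty
  \<comment> \<open>With no constraint left, the assumption says that all of \<open>V\<close>
    vanishes on \<open>A\<close>.\<close>
  have "orth_proj V (indicator {x}) x = 0" if "x \<in> A" for x
    using empty(2)[of "orth_proj V (indicator {x})" x] orth_proj(1)[OF empty(1)] that by simp
  then show ?case by simp
next
  case (insert b B)
  note V = insert.prems(1)
  note Vl2 = closed_subspaceD(1)[OF V]
  define q where "q = orth_proj V (indicator {b})"
  have q: "q \<in> V" unfolding q_def by (intro orth_proj V) simp
  have qv: "l2_inner v q = v b" if "v \<in> V" for v
    using orth_proj(4)[OF V indicator_in_l2 that, of b] by (simp add: q_def)
  define W where "W = {f \<in> V. \<forall>u\<in>{q}. l2_inner f u = 0}"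
  have W: "closed_subspace W"
    unfolding W_def by (rule closed_subspace_orthogonal[OF V]) (use q Vl2 in auto)
  have Wb: "v \<in> W \<longleftrightarrow> v \<in> V \<and> v b = 0" for v
    using qv by (auto simp: W_def)
  have IH: "(\<Sum>x\<in>A. Re (orth_proj W (indicator {x}) x)) \<le> real (card B)"
    proof (rule insert.IH[OF W])
    show "v x = 0" if "v \<in> W" and "\<And>b. b \<in> B \<Longrightarrow> v b = 0" and "x \<in> A" for v x
      using insert.prems(2)[of v x] that Wb by auto
  qed
  show ?case
  proof (cases "l2_norm q = 0")
    \<comment> \<open>Since \<open>q\<close> represents evaluation at \<open>b\<close> on
      \<open>V\<close>, this is the case in which the new constraint already holds on
      \<open>V\<close>.\<close>
    case True
    then have "v b = 0" if "v \<in> V" for v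
      using l2_Cauchy_Schwarz[OF Vl2[OF that] Vl2[OF q]] qv[OF that] by simp
    then have "W = V" using Wb by blast
    then show ?thesis using IH insert.hyps by simp
  next
    case False
    then have pos: "l2_norm q > 0" using l2_norm_ge_0[of q] by linarith
    \<comment> \<open>The unit vector along \<open>q\<close>. The projection onto \<open>W\<close>
      is the projection onto \<open>V\<close> minus the rank-one projection onto the line of
      \<open>u\<close>.\<close>
    define u where "u = (\<lambda>x. of_real (1 / l2_norm q) * q x)"
    have u: "u \<in> V" unfolding u_def by (rule closed_subspaceD(4)[OF V q])
    have u1: "l2_norm u = 1" unfolding u_def by (subst l2_norm_scale) (use pos in \<open>simp add: norm_divide\<close>)
    have uW: "l2_inner u v = 0" if "v \<in> W" for v
      using that l2_inner_commute[of q v] l2_inner_scale_left[of "of_real (1 / l2_norm q)" q v]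
      unfolding u_def W_def by simp
    have ub: "u b = of_real (l2_norm q)"
      using qv[OF q, symmetric] pos by (simp add: u_def l2_inner_self power2_eq_square)
    have P: "orth_proj W f = (\<lambda>x. orth_proj V f x + (- l2_inner f u) * u x)" (is "_ = ?p")
      if f: "f \<in> l2 UNIV" for f
    proof (rule orth_proj_eqI[OF W f])
      note Pf = orth_proj[OF V f]
      have pV: "?p \<in> V" by (rule closed_subspaceD(3)[OF V Pf(1) u])
      have "orth_proj V f b = l2_inner f u * u b"
      proof -
        have qu: "q = (\<lambda>x. of_real (l2_norm q) * u x)" using pos by (auto simp: u_def)
        have "orth_proj V f b = l2_inner f q" using qv[OF Pf(1)] Pf(3)[OF q] by simp
        also have "\<dots> = cnj (of_real (l2_norm q) * l2_inner u f)"
          by (subst l2_inner_commute, subst qu, subst l2_inner_scale_left) (rule refl)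
        also have "\<dots> = l2_inner f u * u b"
          by (simp add: ub l2_inner_commute[of f u])
        finally show ?thesis .
      qed
      then show "?p \<in> W" using pV Wb by simp
      fix v assume v: "v \<in> W"
      then have vV: "v \<in> V" by (simp add: Wb)
      have "l2_inner ?p v = l2_inner f v"
        using l2_inner_lincomb_left[OF Vl2[OF Pf(1)] Vl2[OF u] Vl2[OF vV], of "- l2_inner f u"]
          Pf(3)[OF vV] uW[OF v] by simp
      then show "l2_inner (\<lambda>x. f x - ?p x) v = 0"
        using l2_inner_diff_left[OF f Vl2[OF pV] Vl2[OF vV]] by simp
    qed
    have "Re (orth_proj V (indicator {x}) x) = Re (orth_proj W (indicator {x}) x) + (cmod (u x))\<^sup>2" for x
    proof -
      have "l2_inner (indicator {x}) u = cnj (u x)"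
        by (subst l2_inner_commute) simp
      then have "orth_proj W (indicator {x}) x = orth_proj V (indicator {x}) x - u x * cnj (u x)"
        using P[of "indicator {x}"] by simp
      then show ?thesis by (simp add: complex_norm_square[symmetric])
    qed
    then have "(\<Sum>x\<in>A. Re (orth_proj V (indicator {x}) x)) =
        (\<Sum>x\<in>A. Re (orth_proj W (indicator {x}) x)) + (\<Sum>x\<in>A. (cmod (u x))\<^sup>2)"
      by (simp add: sum.distrib)
    \<comment> \<open>The diagonal of a rank-one projection sums to 1 over all coordinates, hence to
      at most 1 over \<open>A\<close>.\<close>
    moreover have "(\<Sum>x\<in>A. (cmod (u x))\<^sup>2) \<le> 1"
      using L2_set_le_l2_norm[OF Vl2[OF u] \<open>finite A\<close>] u1 by (simp add: L2_set_def)
    ultimately show ?thesis using IH insert.hyps by simp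
  qed
qed

section \<open>Left translations of ordered pairs\<close>

definition pair_act :: "('a, 'b) monoid_scheme \<Rightarrow> 'a \<Rightarrow> 'a \<times> 'a \<Rightarrow> 'a \<times> 'a" where
  "pair_act G g p = (g \<otimes>\<^bsub>G\<^esub> fst p, g \<otimes>\<^bsub>G\<^esub> snd p)"

text \<open>
  The pull-back of a function under left translation by \<open>g\<close>, which is the action of the inverse of \<open>g\<close>
  on functions supported on the pairs of elements of \<open>G\<close>.
\<close>

definition translate ::
  "('a, 'b) monoid_scheme \<Rightarrow> 'a \<Rightarrow> ('a \<times> 'a \<Rightarrow> complex) \<Rightarrow> 'a \<times> 'a \<Rightarrow> complex" where
  "translate G g f = (\<lambda>p. if p \<in> carrier G \<times> carrier G then f (pair_act G g p) else 0)"

definition left_invariant :: "('a, 'b) monoid_scheme \<Rightarrow> ('a \<times> 'a) set \<Rightarrow> bool" where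
  "left_invariant G X \<longleftrightarrow> X \<subseteq> carrier G \<times> carrier G \<and>
     (\<forall>g\<in>carrier G. \<forall>p\<in>X. pair_act G g p \<in> X)"

definition translation_invariant ::
  "('a, 'b) monoid_scheme \<Rightarrow> ('a \<times> 'a \<Rightarrow> complex) set \<Rightarrow> bool" where
  "translation_invariant G V \<longleftrightarrow> (\<forall>g\<in>carrier G. \<forall>v\<in>V. translate G g v \<in> V)"

text \<open>A morphism of Hilbert modules. All conditions are relative to \<open>V\<close> because
  \<open>U\<close> is a total function on all functions, meaningful only on its domain.\<close>

definition bounded_equivariant :: "('a, 'b) monoid_scheme \<Rightarrow> ('a \<times> 'a \<Rightarrow> complex) set \<Rightarrow>
    ('a \<times> 'a \<Rightarrow> complex) set \<Rightarrow> (('a \<times> 'a \<Rightarrow> complex) \<Rightarrow> 'a \<times> 'a \<Rightarrow> complex) \<Rightarrow> bool" where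
  "bounded_equivariant G V W U \<longleftrightarrow> (\<forall>f\<in>V. U f \<in> W) \<and>
     (\<forall>f\<in>V. \<forall>h\<in>V. \<forall>a. U (\<lambda>x. f x + a * h x) = (\<lambda>x. U f x + a * U h x)) \<and>
     (\<exists>C. \<forall>f\<in>V. l2_norm (U f) \<le> C * l2_norm f) \<and>
     (\<forall>g\<in>carrier G. \<forall>f\<in>V. U (translate G g f) = translate G g (U f))"

section \<open>Translations as unitary operators\<close>

context group
begin

lemma pair_act_closed [simp]:
  "g \<in> carrier G \<Longrightarrow> p \<in> carrier G \<times> carrier G \<Longrightarrow> pair_act G g p \<in> carrier G \<times> carrier G"
  by (auto simp: pair_act_def)

lemma pair_act_one [simp]: "p \<in> carrier G \<times> carrier G \<Longrightarrow> pair_act G \<one> p = p"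
  by (auto simp: pair_act_def)

lemma pair_act_mult:
  "g \<in> carrier G \<Longrightarrow> h \<in> carrier G \<Longrightarrow> p \<in> carrier G \<times> carrier G \<Longrightarrow>
    pair_act G g (pair_act G h p) = pair_act G (g \<otimes> h) p"
  by (auto simp: pair_act_def m_assoc)

lemma pair_act_inv [simp]:
  assumes "g \<in> carrier G" and "p \<in> carrier G \<times> carrier G"
  shows "pair_act G g (pair_act G (inv g) p) = p" and "pair_act G (inv g) (pair_act G g p) = p"
  using assms by (simp_all add: pair_act_mult del: mem_Times_iff)

lemma bij_betw_pair_act:
  assumes g: "g \<in> carrier G"
  shows "bij_betw (pair_act G g) (carrier G \<times> carrier G) (carrier G \<times> carrier G)"
proof (rule bij_betw_byWitness[where f' = "pair_act G (inv g)"])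
  show "pair_act G g ` (carrier G \<times> carrier G) \<subseteq> carrier G \<times> carrier G"
    and "pair_act G (inv g) ` (carrier G \<times> carrier G) \<subseteq> carrier G \<times> carrier G"
    using pair_act_closed[OF g] pair_act_closed[OF inv_closed[OF g]] by blast+
qed (use pair_act_inv[OF g] in blast)+

lemma left_invariantD:
  assumes "left_invariant G X"
  shows "p \<in> X \<Longrightarrow> p \<in> carrier G \<times> carrier G"
    and "g \<in> carrier G \<Longrightarrow> p \<in> X \<Longrightarrow> pair_act G g p \<in> X"
    and "f \<in> l2 X \<Longrightarrow> p \<notin> carrier G \<times> carrier G \<Longrightarrow> f p = 0"
  using assms unfolding left_invariant_def l2_def by blast+

lemma left_invariant_iff:
  assumes "left_invariant G X" and "g \<in> carrier G" and "p \<in> carrier G \<times> carrier G"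
  shows "pair_act G g p \<in> X \<longleftrightarrow> p \<in> X"
  using assms left_invariantD(2)[OF assms(1)] pair_act_inv(2) inv_closed by metis

lemma translate_l2:
  assumes X: "left_invariant G X" and g: "g \<in> carrier G" and f: "f \<in> l2 X"
  shows "translate G g f \<in> l2 X" and "l2_norm (translate G g f) \<le> l2_norm f"
proof -
  have "inj_on (pair_act G g) {p. translate G g f p \<noteq> 0}"
    using bij_betw_imp_inj_on[OF bij_betw_pair_act[OF g]]
    by (rule inj_on_subset) (auto simp: translate_def split: if_splits)
  note R = l2_reindex[OF l2_subset_UNIV[OF f] this]
  have "translate G g f p = 0" if "p \<notin> X" for p
  proof -
    have "f q = 0" if "q \<notin> X" for q using f that unfolding l2_def by blast
    then show ?thesis
      unfolding translate_def using that left_invariant_iff[OF X g, of p] by simp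
  qed
  moreover have "translate G g f \<in> l2 UNIV"
    by (rule R) (simp add: translate_def)
  ultimately show "translate G g f \<in> l2 X"
    using l2_iff by blast
  show "l2_norm (translate G g f) \<le> l2_norm f"
    by (rule R) (simp add: translate_def)
qed

text \<open>Pull-backs compose in the opposite order, whence \<open>h \<otimes> g\<close>.\<close>

lemma translate_translate:
  assumes "g \<in> carrier G" and "h \<in> carrier G"
  shows "translate G g (translate G h f) = translate G (h \<otimes> g) f"
  unfolding translate_def using assms
  by (auto simp: pair_act_mult simp del: mem_Times_iff mem_Sigma_iff)

lemma translate_inv:
  assumes "left_invariant G X" and "g \<in> carrier G" and "f \<in> l2 X"
  shows "translate G g (translate G (inv g) f) = f"
proof -
  have "translate G \<one> f = f"
    unfolding translate_def using left_invariantD(3)[OF assms(1,3)]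
    by (auto simp del: mem_Times_iff mem_Sigma_iff)
  then show ?thesis using assms by (simp add: translate_translate)
qed

lemma translate_indicator:
  assumes "g \<in> carrier G" and "p \<in> carrier G \<times> carrier G"
  shows "translate G g (indicator {pair_act G g p}) = indicator {p}"
proof -
  have "pair_act G g q = pair_act G g p \<longleftrightarrow> q = p" if "q \<in> carrier G \<times> carrier G" for q
    using assms that pair_act_inv(2) by metis
  then show ?thesis
    unfolding translate_def indicator_def using assms
    by (auto simp del: mem_Times_iff mem_Sigma_iff)
qed

lemma l2_inner_translate:
  assumes X: "left_invariant G X" and g: "g \<in> carrier G" and f: "f \<in> l2 X"
  shows "l2_inner (translate G g f) (translate G g h) = l2_inner f h"
proof -
  let ?C = "carrier G \<times> carrier G"
  have "l2_inner (translate G g f) (translate G g h) =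
      (\<Sum>\<^sub>\<infinity>p\<in>?C. f (pair_act G g p) * cnj (h (pair_act G g p)))"
    unfolding l2_inner_def by (rule infsum_cong_neutral) (auto simp: translate_def)
  also have "\<dots> = (\<Sum>\<^sub>\<infinity>p\<in>?C. f p * cnj (h p))"
    by (rule infsum_reindex_bij_betw[OF bij_betw_pair_act[OF g], of "\<lambda>p. f p * cnj (h p)"])
  also have "\<dots> = l2_inner f h"
    unfolding l2_inner_def
    by (rule infsum_cong_neutral) (use left_invariantD(3)[OF X f] in auto)
  finally show ?thesis .
qed

lemma l2_inner_translate_left:
  assumes X: "left_invariant G X" and g: "g \<in> carrier G" and f: "f \<in> l2 X" and h: "h \<in> l2 X"
  shows "l2_inner (translate G g f) h = l2_inner f (translate G (inv g) h)"
  using l2_inner_translate[OF X g f, of "translate G (inv g) h"] translate_inv[OF X g h] by simp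

text \<open>The adjoint of a translation is the translation by the inverse, which also preserves
  \<open>V\<close>; so the translated projection satisfies the orthogonality that characterises the
  projection.\<close>

lemma orth_proj_translate:
  assumes X: "left_invariant G X" and V: "closed_subspace V" "V \<subseteq> l2 X" "translation_invariant G V"
    and g: "g \<in> carrier G" and f: "f \<in> l2 X"
  shows "orth_proj V (translate G g f) = translate G g (orth_proj V f)"
proof (rule orth_proj_eqI[OF V(1)])
  note P = orth_proj[OF V(1) l2_subset_UNIV[OF f]]
  have PX: "orth_proj V f \<in> l2 X" using P(1) V(2) by blast
  show t: "translate G g f \<in> l2 UNIV" by (rule l2_subset_UNIV[OF translate_l2(1)[OF X g f]])
  show p: "translate G g (orth_proj V f) \<in> V"
    using P(1) V(3) g by (auto simp: translation_invariant_def)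
  fix v assume v: "v \<in> V"
  have v': "translate G (inv g) v \<in> V" using V(3) g v by (auto simp: translation_invariant_def)
  have vX: "v \<in> l2 X" using v V by blast
  have "l2_inner (translate G g f) v = l2_inner (translate G g (orth_proj V f)) v"
    using l2_inner_translate_left[OF X g f vX] l2_inner_translate_left[OF X g PX vX] P(3)[OF v'] by simp
  then show "l2_inner (\<lambda>x. translate G g f x - translate G g (orth_proj V f) x) v = 0"
    using l2_inner_diff_left[OF t] closed_subspaceD(1)[OF V(1)] p v by simp
qed

lemma indicator_in_l2_on: "p \<in> X \<Longrightarrow> (indicator {p} :: _ \<Rightarrow> complex) \<in> l2 X"
  by (subst l2_iff) (auto simp: indicator_def)

lemma orth_proj_diagonal_invariant:
  assumes X: "left_invariant G X" and V: "closed_subspace V" "V \<subseteq> l2 X" "translation_invariant G V"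
    and g: "g \<in> carrier G" and p: "p \<in> X"
  shows "orth_proj V (indicator {pair_act G g p}) (pair_act G g p) = orth_proj V (indicator {p}) p"
proof -
  note pC = left_invariantD(1)[OF X p]
  have "orth_proj V (indicator {p}) = translate G g (orth_proj V (indicator {pair_act G g p}))"
    using orth_proj_translate[OF X V g indicator_in_l2_on[OF left_invariantD(2)[OF X g p]]]
      translate_indicator[OF g pC] by simp
  then show ?thesis using pC by (simp add: translate_def del: mem_Times_iff)
qed

section \<open>Sums over orbits and the trace\<close>

lemma vn_dim_eq: "vn_dim F V = (\<Sum>e\<in>F. Re (orth_proj V (indicator {e}) e))"
  by (simp add: vn_dim_def)

text \<open>The action on ordered pairs is free: if \<open>e\<close> starts at the neutral element,
  the first component of \<open>pair_act G g e\<close> is \<open>g\<close>, which then determines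
  \<open>e\<close>.\<close>

lemma inj_on_pair_act:
  "inj_on (\<lambda>(g, e). pair_act G g e) (carrier G \<times> {e \<in> carrier G \<times> carrier G. fst e = \<one>})"
  by (rule inj_onI) (auto simp: pair_act_def)

lemma pair_act_base:
  assumes "left_invariant G X" and "p \<in> X"
  shows "pair_act G (fst p) (pair_act G (inv (fst p)) p) = p"
    and "pair_act G (inv (fst p)) p \<in> {e \<in> X. fst e = \<one>}"
proof -
  have "fst p \<in> carrier G" "snd p \<in> carrier G"
    using left_invariantD(1)[OF assms] by auto
  then show "pair_act G (fst p) (pair_act G (inv (fst p)) p) = p"
    and "pair_act G (inv (fst p)) p \<in> {e \<in> X. fst e = \<one>}"
    using left_invariantD(2)[OF assms(1) _ assms(2), of "inv (fst p)"]
    by (simp_all add: pair_act_def m_assoc[symmetric])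
qed

text \<open>The pairs starting in \<open>A\<close> are the disjoint translates by elements of
  \<open>A\<close> of those starting at the neutral element, and translation does not change
  diagonal coefficients.\<close>

lemma sum_orth_proj_diagonal_translates:
  assumes X: "left_invariant G X" and V: "closed_subspace V" "V \<subseteq> l2 X" "translation_invariant G V"
    and A: "A \<subseteq> carrier G"
  shows "(\<Sum>p | p \<in> X \<and> fst p \<in> A. Re (orth_proj V (indicator {p}) p)) =
    card A * vn_dim {e \<in> X. fst e = \<one>} V"
proof -
  let ?F = "{e \<in> X. fst e = \<one>}" and ?d = "\<lambda>p. Re (orth_proj V (indicator {p}) p)"
  have C: "p \<in> X \<Longrightarrow> p \<in> carrier G \<times> carrier G" for p by (rule left_invariantD(1)[OF X])
  have "bij_betw (\<lambda>(g, e). pair_act G g e) (A \<times> ?F) {p. p \<in> X \<and> fst p \<in> A}"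
  proof (rule bij_betw_imageI)
    show "inj_on (\<lambda>(g, e). pair_act G g e) (A \<times> ?F)"
      by (rule inj_on_subset[OF inj_on_pair_act]) (use A C in auto)
    show "(\<lambda>(g, e). pair_act G g e) ` (A \<times> ?F) = {p. p \<in> X \<and> fst p \<in> A}"
    proof (intro equalityI subsetI)
      fix p assume "p \<in> (\<lambda>(g, e). pair_act G g e) ` (A \<times> ?F)"
      then obtain g e where "p = pair_act G g e" "g \<in> A" "e \<in> X" "fst e = \<one>" by force
      then show "p \<in> {p. p \<in> X \<and> fst p \<in> A}"
        using A left_invariantD(2)[OF X, of g e] by (auto simp: pair_act_def)
    next
      fix p assume "p \<in> {p. p \<in> X \<and> fst p \<in> A}"
      then show "p \<in> (\<lambda>(g, e). pair_act G g e) ` (A \<times> ?F)"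
        using pair_act_base[OF X, of p]
        by (intro image_eqI[of _ _ "(fst p, pair_act G (inv (fst p)) p)"]) auto
    qed
  qed
  from sum.reindex_bij_betw[OF this, of ?d]
  have "(\<Sum>p | p \<in> X \<and> fst p \<in> A. ?d p) = (\<Sum>(g, e)\<in>A \<times> ?F. ?d (pair_act G g e))"
    by (simp add: case_prod_unfold)
  also have "\<dots> = (\<Sum>(g, e)\<in>A \<times> ?F. ?d e)"
    using orth_proj_diagonal_invariant[OF X V] A by (intro sum.cong) auto
  also have "\<dots> = card A * vn_dim ?F V"
    by (simp add: vn_dim_eq sum.cartesian_product[symmetric])
  finally show ?thesis .
qed

text \<open>There are finitely many orbits, one for each pair starting at the neutral element, and
  each is a copy of the group because the action is free.\<close>

lemma infsum_orbits:
  fixes f :: "'a \<times> 'a \<Rightarrow> complex"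
  assumes X: "left_invariant G X" and fin: "finite {e \<in> X. fst e = \<one>}" and f: "f summable_on X"
  shows "infsum f X = (\<Sum>e | e \<in> X \<and> fst e = \<one>. \<Sum>\<^sub>\<infinity>g\<in>carrier G. f (pair_act G g e))"
proof -
  let ?F = "{e \<in> X. fst e = \<one>}" and ?O = "\<lambda>e. (\<lambda>g. pair_act G g e) ` carrier G"
  have C: "p \<in> X \<Longrightarrow> p \<in> carrier G \<times> carrier G" for p by (rule left_invariantD(1)[OF X])
  have inj: "e \<in> ?F \<Longrightarrow> e' \<in> ?F \<Longrightarrow> g \<in> carrier G \<Longrightarrow> g' \<in> carrier G \<Longrightarrow>
      pair_act G g e = pair_act G g' e' \<Longrightarrow> g = g' \<and> e = e'" for e e' g g'
    using inj_onD[OF inj_on_pair_act, of "(g, e)" "(g', e')"] C by auto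
  have OX: "?O e \<subseteq> X" if "e \<in> ?F" for e
    using that left_invariantD(2)[OF X] by blast
  have "X = (\<Union>e\<in>?F. ?O e)"
  proof
    show "X \<subseteq> (\<Union>e\<in>?F. ?O e)"
    proof
      fix p assume p: "p \<in> X"
      have "p \<in> ?O (pair_act G (inv (fst p)) p)"
        using pair_act_base(1)[OF X p] C[OF p] by (intro image_eqI[of _ _ "fst p"]) auto
      then show "p \<in> (\<Union>e\<in>?F. ?O e)" using pair_act_base(2)[OF X p] by blast
    qed
  qed (use OX in blast)
  then have "infsum f X = infsum f (\<Union>e\<in>?F. ?O e)" by simp
  also have "\<dots> = (\<Sum>e\<in>?F. infsum f (?O e))"
  proof (rule sum_infsum[symmetric, OF fin])
    show "f summable_on ?O e" if "e \<in> ?F" for e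
      using summable_on_subset_banach[OF f OX[OF that]] .
    show "?O e \<inter> ?O e' = {}" if "e \<in> ?F" "e' \<in> ?F" "e \<noteq> e'" for e e'
      using inj[OF that(1,2)] that(3) by blast
  qed
  also have "\<dots> = (\<Sum>e\<in>?F. \<Sum>\<^sub>\<infinity>g\<in>carrier G. f (pair_act G g e))"
  proof (rule sum.cong[OF refl])
    fix e assume e: "e \<in> ?F"
    have "inj_on (\<lambda>g. pair_act G g e) (carrier G)"
      using inj[OF e e] by (intro inj_onI) blast
    from infsum_reindex[OF this, of f]
    show "infsum f (?O e) = (\<Sum>\<^sub>\<infinity>g\<in>carrier G. f (pair_act G g e))"
      by (simp add: o_def)
  qed
  finally show ?thesis .
qed

text \<open>This is the trace property \<open>tr (A B) = tr (B A)\<close>, in terms of kernels.\<close>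

lemma infsum_kernel_swap:
  fixes m :: "'a \<times> 'a \<Rightarrow> 'a \<times> 'a \<Rightarrow> complex"
  assumes X: "left_invariant G X" "finite {e \<in> X. fst e = \<one>}"
    and Y: "left_invariant G Y" "finite {e \<in> Y. fst e = \<one>}"
    and sX: "\<And>x. x \<in> X \<Longrightarrow> m x summable_on Y" and sY: "\<And>y. y \<in> Y \<Longrightarrow> (\<lambda>x. m x y) summable_on X"
    and inv: "\<And>g x y. g \<in> carrier G \<Longrightarrow> x \<in> X \<Longrightarrow> y \<in> Y \<Longrightarrow>
      m (pair_act G g x) (pair_act G g y) = m x y"
  shows "(\<Sum>x | x \<in> X \<and> fst x = \<one>. infsum (m x) Y) = (\<Sum>y | y \<in> Y \<and> fst y = \<one>. \<Sum>\<^sub>\<infinity>x\<in>X. m x y)"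
proof -
  let ?FX = "{e \<in> X. fst e = \<one>}" and ?FY = "{e \<in> Y. fst e = \<one>}"
  have "(\<Sum>x\<in>?FX. infsum (m x) Y) = (\<Sum>x\<in>?FX. \<Sum>y\<in>?FY. \<Sum>\<^sub>\<infinity>g\<in>carrier G. m x (pair_act G g y))"
    using sX by (intro sum.cong[OF refl] infsum_orbits[OF Y]) auto
  \<comment> \<open>Only the two finite sums over base pairs are exchanged here; the exchange of the
    infinite sums is reduced to a substitution in the group.\<close>
  also have "\<dots> = (\<Sum>y\<in>?FY. \<Sum>x\<in>?FX. \<Sum>\<^sub>\<infinity>g\<in>carrier G. m x (pair_act G g y))"
    by (rule sum.swap)
  also have "\<dots> = (\<Sum>y\<in>?FY. \<Sum>x\<in>?FX. \<Sum>\<^sub>\<infinity>g\<in>carrier G. m (pair_act G g x) y)"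
  proof (intro sum.cong[OF refl])
    fix x y assume "y \<in> ?FY" and "x \<in> ?FX"
    then have x: "x \<in> X" and y: "y \<in> Y" by auto
    \<comment> \<open>Invariance under \<open>g\<close>, applied to the inverse translate of
      \<open>x\<close> and to \<open>y\<close>, moves the translation from the second argument to
      the first. Inversion is a bijection of the group, which removes the inverse
      afterwards.\<close>
    have "m x (pair_act G g y) = m (pair_act G (inv g) x) y" if g: "g \<in> carrier G" for g
      using inv[OF g left_invariantD(2)[OF X(1) inv_closed[OF g] x] y] g
        pair_act_inv(1)[OF g left_invariantD(1)[OF X(1) x]] by simp
    then have "(\<Sum>\<^sub>\<infinity>g\<in>carrier G. m x (pair_act G g y)) = (\<Sum>\<^sub>\<infinity>g\<in>carrier G. m (pair_act G (inv g) x) y)"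
      by (intro infsum_cong) auto
    also have "\<dots> = (\<Sum>\<^sub>\<infinity>g\<in>carrier G. m (pair_act G g x) y)"
    proof (rule infsum_reindex_bij_betw)
      show "bij_betw (m_inv G) (carrier G) (carrier G)"
        by (rule bij_betw_byWitness[where f' = "m_inv G"]) auto
    qed
    finally show "(\<Sum>\<^sub>\<infinity>g\<in>carrier G. m x (pair_act G g y)) = (\<Sum>\<^sub>\<infinity>g\<in>carrier G. m (pair_act G g x) y)" .
  qed
  also have "\<dots> = (\<Sum>y\<in>?FY. \<Sum>\<^sub>\<infinity>x\<in>X. m x y)"
    using sY by (intro sum.cong[OF refl] infsum_orbits[OF X, symmetric]) auto
  finally show ?thesis .
qed

text \<open>Evaluation of \<open>U w\<close> at \<open>x\<close> is a bounded functional, hence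
  given by some \<open>c\<close> in \<open>W\<close>. Projecting a basis vector onto
  \<open>W\<close> does not change its product with \<open>c\<close>, so the conjugates of the
  values of \<open>c\<close> are the matrix coefficients of \<open>U\<close> after
  projection.\<close>

lemma bounded_equivariant_kernel:
  assumes U: "bounded_equivariant G W V U" and V: "V \<subseteq> l2 UNIV" and W: "closed_subspace W" and w: "w \<in> W"
  shows "((\<lambda>y. w y * U (orth_proj W (indicator {y})) x) has_sum U w x) UNIV"
proof -
  obtain C where C: "\<And>f. f \<in> W \<Longrightarrow> l2_norm (U f) \<le> C * l2_norm f"
    using U unfolding bounded_equivariant_def by blast
  have UV: "U f \<in> l2 UNIV" if "f \<in> W" for f using U V that unfolding bounded_equivariant_def by blast
  obtain c where c: "c \<in> W" and rep: "\<And>f. f \<in> W \<Longrightarrow> U f x = l2_inner f c"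
  proof (rule Riesz_representation[OF W, of "\<lambda>f. U f x" C])
    show "U (\<lambda>x. f x + a * g x) x = U f x + a * U g x" if "f \<in> W" "g \<in> W" for f g a
      using U that unfolding bounded_equivariant_def by simp
    show "cmod (U f x) \<le> C * l2_norm f" if "f \<in> W" for f
      using cmod_le_l2_norm[OF UV[OF that], of x] C[OF that] by linarith
  qed (rule that)
  have "cnj (c y) = U (orth_proj W (indicator {y})) x" for y
    using rep[OF orth_proj(1)[OF W]] orth_proj(3)[OF W _ c, of "indicator {y}"]
      l2_inner_commute[of "indicator {y}" c] by simp
  moreover have "((\<lambda>y. w y * cnj (c y)) has_sum l2_inner w c) UNIV"
    unfolding l2_inner_def
    using closed_subspaceD(1)[OF W] w c by (intro has_sum_infsum l2_mult_summable) auto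
  ultimately show ?thesis using rep[OF w] by simp
qed

lemma bounded_equivariant_kernel_invariant:
  assumes X: "left_invariant G X" and V: "closed_subspace V" "V \<subseteq> l2 X" "translation_invariant G V"
    and Y: "left_invariant G Y" and U: "bounded_equivariant G V W U"
    and g: "g \<in> carrier G" and x: "x \<in> X" and y: "y \<in> Y"
  shows "U (orth_proj V (indicator {pair_act G g x})) (pair_act G g y) = U (orth_proj V (indicator {x})) y"
proof -
  note xC = left_invariantD(1)[OF X x] and yC = left_invariantD(1)[OF Y y]
  have "orth_proj V (indicator {x}) = translate G g (orth_proj V (indicator {pair_act G g x}))"
    using orth_proj_translate[OF X V g indicator_in_l2_on[OF left_invariantD(2)[OF X g x]]]
      translate_indicator[OF g xC] by simp
  moreover have "U (translate G g (orth_proj V f)) = translate G g (U (orth_proj V f))" if "f \<in> l2 UNIV" for f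
    using U g orth_proj(1)[OF V(1) that] unfolding bounded_equivariant_def by blast
  ultimately show ?thesis using yC by (simp add: translate_def del: mem_Times_iff)
qed

text \<open>Since \<open>U' U\<close> and \<open>U U'\<close> are the identities of \<open>V\<close>
  and \<open>W\<close>, composing with the projections expresses the dimensions as the traces of a
  product of two kernels in its two orders.\<close>

lemma vn_dim_isomorphic:
  assumes X: "left_invariant G X" "finite {e \<in> X. fst e = \<one>}"
    and V: "closed_subspace V" "V \<subseteq> l2 X" "translation_invariant G V"
    and Y: "left_invariant G Y" "finite {e \<in> Y. fst e = \<one>}"
    and W: "closed_subspace W" "W \<subseteq> l2 Y" "translation_invariant G W"
    and U: "bounded_equivariant G V W U" and U': "bounded_equivariant G W V U'"
    and id: "\<And>v. v \<in> V \<Longrightarrow> U' (U v) = v" "\<And>w. w \<in> W \<Longrightarrow> U (U' w) = w"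
  shows "vn_dim {e \<in> X. fst e = \<one>} V = vn_dim {e \<in> Y. fst e = \<one>} W"
proof -
  \<comment> \<open>The column at \<open>x\<close> of the matrix of \<open>U\<close> composed with
    the projection onto \<open>V\<close>; \<open>k'\<close> plays the same role for
    \<open>U'\<close>. Their products \<open>k x y * k' y x\<close> give both diagonals, according
    to the variable summed over.\<close>
  define k where "k x = U (orth_proj V (indicator {x}))" for x
  define k' where "k' y = U' (orth_proj W (indicator {y}))" for y
  have kW: "k x \<in> W" for x
    using U orth_proj(1)[OF V(1), of "indicator {x}"] unfolding k_def bounded_equivariant_def by auto
  have kV: "k' y \<in> V" for y
    using U' orth_proj(1)[OF W(1), of "indicator {y}"] unfolding k'_def bounded_equivariant_def by auto
  have sum1: "((\<lambda>y. k x y * k' y x) has_sum orth_proj V (indicator {x}) x) Y" for x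
  proof -
    have "((\<lambda>y. k x y * k' y x) has_sum U' (k x) x) UNIV"
      unfolding k'_def using V(1) by (intro bounded_equivariant_kernel[OF U' _ W(1) kW]) (auto dest: closed_subspaceD)
    also have "U' (k x) = orth_proj V (indicator {x})"
      unfolding k_def by (intro id orth_proj V) simp
    also have "((\<lambda>y. k x y * k' y x) has_sum orth_proj V (indicator {x}) x) UNIV \<longleftrightarrow> ?thesis"
      by (rule has_sum_cong_neutral) (use kW[of x] W(2) in \<open>auto simp: l2_def\<close>)
    finally show ?thesis .
  qed
  have sum2: "((\<lambda>x. k x y * k' y x) has_sum orth_proj W (indicator {y}) y) X" for y
  proof -
    have "((\<lambda>x. k' y x * k x y) has_sum U (k' y) y) UNIV"
      unfolding k_def using W(1) by (intro bounded_equivariant_kernel[OF U _ V(1) kV]) (auto dest: closed_subspaceD)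
    also have "U (k' y) = orth_proj W (indicator {y})"
      unfolding k'_def by (intro id orth_proj W) simp
    also have "((\<lambda>x. k' y x * k x y) has_sum orth_proj W (indicator {y}) y) UNIV \<longleftrightarrow>
        ((\<lambda>x. k x y * k' y x) has_sum orth_proj W (indicator {y}) y) X"
      by (rule has_sum_cong_neutral) (use kV[of y] V(2) in \<open>auto simp: l2_def\<close>)
    finally show ?thesis .
  qed
  have "(\<Sum>x | x \<in> X \<and> fst x = \<one>. \<Sum>\<^sub>\<infinity>y\<in>Y. k x y * k' y x) =
      (\<Sum>y | y \<in> Y \<and> fst y = \<one>. \<Sum>\<^sub>\<infinity>x\<in>X. k x y * k' y x)"
  proof (rule infsum_kernel_swap[OF X Y])
    show "(\<lambda>y. k x y * k' y x) summable_on Y" for x by (rule has_sum_imp_summable[OF sum1])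
    show "(\<lambda>x. k x y * k' y x) summable_on X" for y by (rule has_sum_imp_summable[OF sum2])
    show "k (pair_act G g x) (pair_act G g y) * k' (pair_act G g y) (pair_act G g x) = k x y * k' y x"
      if "g \<in> carrier G" "x \<in> X" "y \<in> Y" for g x y
      unfolding k_def k'_def
      using bounded_equivariant_kernel_invariant[OF X(1) V Y(1) U that]
        bounded_equivariant_kernel_invariant[OF Y(1) W X(1) U' that(1,3,2)] by simp
  qed
  then have "(\<Sum>x | x \<in> X \<and> fst x = \<one>. orth_proj V (indicator {x}) x) =
      (\<Sum>y | y \<in> Y \<and> fst y = \<one>. orth_proj W (indicator {y}) y)"
    by (simp only: infsumI[OF sum1] infsumI[OF sum2])
  then show ?thesis
    unfolding vn_dim_eq by (simp only: Re_sum[symmetric])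
qed

end

section \<open>Harmonic forms on locally finite graphs\<close>

definition harmonic_forms :: "'v set set \<Rightarrow> ('v \<times> 'v \<Rightarrow> complex) set" where
  "harmonic_forms E =
     orth_complement_in (l2_cycles E) (l2_closure (oriented_edges E) (finite_cycles E))"

text \<open>On a Cayley graph these turn out to be exactly the square-summable gradients. The
  divergence condition is separated from them so that it can be tested on gradients of point
  masses.\<close>

definition closed_forms :: "'v set set \<Rightarrow> ('v \<times> 'v \<Rightarrow> complex) set" where
  "closed_forms E = {c \<in> l2 (oriented_edges E).
     (\<forall>x y. c (y, x) = - c (x, y)) \<and> (\<forall>z\<in>finite_cycles E. l2_inner c z = 0)}"

text \<open>\<open>F\<close> is an arbitrary potential; square-summability is only ever required of
  the gradient.\<close>

definition grad :: "('v \<times> 'v) set \<Rightarrow> ('v \<Rightarrow> complex) \<Rightarrow> 'v \<times> 'v \<Rightarrow> complex" where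
  "grad X F = (\<lambda>p. if p \<in> X then F (snd p) - F (fst p) else 0)"

lemma oriented_edges_iff [simp]: "(x, y) \<in> oriented_edges E \<longleftrightarrow> {x, y} \<in> E"
  by (simp add: oriented_edges_def)

lemma finite_cycles_l2: "finite_cycles E \<subseteq> l2 UNIV"
  unfolding finite_cycles_def l2_cycles_def using l2_subset_UNIV by blast

lemma closed_forms_l2: "closed_forms E \<subseteq> l2 (oriented_edges E)"
  by (auto simp: closed_forms_def)

lemma closed_formsD:
  assumes "c \<in> closed_forms E"
  shows "c \<in> l2 UNIV" and "p \<notin> oriented_edges E \<Longrightarrow> c p = 0" and "c (y, x) = - c (x, y)"
    and "z \<in> finite_cycles E \<Longrightarrow> l2_inner c z = 0"
  using assms l2_iff[of c "oriented_edges E"] unfolding closed_forms_def by blast+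

lemma finite_cyclesD:
  assumes "z \<in> finite_cycles E"
  shows "finite {p. z p \<noteq> 0}" and "p \<notin> oriented_edges E \<Longrightarrow> z p = 0" and "z (y, x) = - z (x, y)"
    and "(\<Sum>y | {x, y} \<in> E. z (x, y)) = 0"
  using assms l2_iff[of z "oriented_edges E"] unfolding finite_cycles_def l2_cycles_def by blast+

lemma finite_cyclesI:
  assumes "finite {p. z p \<noteq> 0}" and "\<And>p. p \<notin> oriented_edges E \<Longrightarrow> z p = 0"
    and "\<And>x y. z (y, x) = - z (x, y)" and "\<And>x. (\<Sum>y | {x, y} \<in> E. z (x, y)) = 0"
  shows "z \<in> finite_cycles E"
  using assms l2_finite_support[OF assms(1)] l2_iff[of z "oriented_edges E"]
  unfolding finite_cycles_def l2_cycles_def by blast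

text \<open>By continuity of the inner product, orthogonality to the closure is orthogonality to the
  finite cycles themselves. Harmonicity thus splits into closedness and vanishing
  divergence.\<close>

lemma harmonic_forms_iff:
  "c \<in> harmonic_forms E \<longleftrightarrow> c \<in> closed_forms E \<and> (\<forall>x. (\<Sum>y | {x, y} \<in> E. c (x, y)) = 0)"
proof -
  have "(\<forall>v\<in>l2_closure (oriented_edges E) (finite_cycles E). l2_inner c v = 0) \<longleftrightarrow>
      (\<forall>z\<in>finite_cycles E. l2_inner c z = 0)" (is "?L \<longleftrightarrow> ?R") if c: "c \<in> l2 UNIV"
  proof
    assume ?L
    have "z \<in> l2_closure (oriented_edges E) (finite_cycles E)" if "z \<in> finite_cycles E" for z
    proof -
      have "l2_norm (\<lambda>x. z x - z x) = 0" by simp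
      moreover have "z \<in> l2 (oriented_edges E)"
        using that by (simp add: finite_cycles_def l2_cycles_def)
      ultimately show ?thesis
        using that unfolding l2_closure_def by (intro CollectI conjI allI impI bexI[of _ z]) simp_all
    qed
    with \<open>?L\<close> show ?R by blast
  next
    assume ?R
    show ?L
    proof
      fix v assume v: "v \<in> l2_closure (oriented_edges E) (finite_cycles E)"
      have "l2_inner v c = 0"
      proof (rule l2_inner_closed[OF _ c finite_cycles_l2])
        show "v \<in> l2 UNIV" using v l2_subset_UNIV by (auto simp: l2_closure_def)
        show "\<exists>u\<in>finite_cycles E. l2_norm (\<lambda>x. v x - u x) < e" if "e > 0" for e
          using v that by (auto simp: l2_closure_def)
        show "l2_inner u c = 0" if "u \<in> finite_cycles E" for u
          using \<open>?R\<close> that l2_inner_commute[of u c] by simp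
      qed
      then show "l2_inner c v = 0" using l2_inner_commute[of c v] by simp
    qed
  qed
  then show ?thesis
    unfolding harmonic_forms_def orth_complement_in_def closed_forms_def l2_cycles_def
    using l2_subset_UNIV by blast
qed

lemma harmonic_forms_subset: "harmonic_forms E \<subseteq> closed_forms E"
  using harmonic_forms_iff by blast

section \<open>Closed and harmonic forms as closed subspaces\<close>

lemma indicator_set_in_l2: "finite A \<Longrightarrow> (indicator A :: 'i \<Rightarrow> complex) \<in> l2 UNIV"
  by (rule l2_finite_support) (rule finite_subset[of _ A], auto simp: indicator_def)

lemma l2_inner_indicator_set: "finite A \<Longrightarrow> l2_inner f (indicator A) = sum f A"
  by (subst l2_inner_finite[of A]) auto

text \<open>Every defining condition is orthogonality to a finitely supported vector: a basis vector
  at a non-edge for the support, the sum of the basis vectors of a pair and its reverse for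
  antisymmetry, and the finite cycles.\<close>

lemma closed_subspace_closed_forms: "closed_subspace (closed_forms E)"
proof -
  define s where "s x y = (\<lambda>p. indicator {(x, y)} p + 1 * indicator {(y, x)} p :: complex)" for x y :: 'a
  define U where "U = (\<lambda>p. indicator {p}) ` (- oriented_edges E) \<union> (\<Union>x y. {s x y}) \<union> finite_cycles E"
  have s: "s x y \<in> l2 UNIV" for x y
    unfolding s_def by (rule l2_lincomb[OF indicator_in_l2 indicator_in_l2])
  have inner_s: "l2_inner f (s x y) = f (x, y) + f (y, x)" if "f \<in> l2 UNIV" for f x y
  proof -
    have "l2_inner f (s x y) = l2_inner f (indicator {(x, y)}) + cnj 1 * l2_inner f (indicator {(y, x)})"
      unfolding s_def by (rule l2_inner_lincomb_right[OF indicator_in_l2 indicator_in_l2 that])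
    then show ?thesis by simp
  qed
  have "U \<subseteq> l2 UNIV"
    unfolding U_def using finite_cycles_l2[of E] s by (intro Un_least image_subsetI UN_least) auto
  then have "closed_subspace {f \<in> l2 UNIV. \<forall>u\<in>U. l2_inner f u = 0}"
    by (rule closed_subspace_orthogonal[OF closed_subspace_UNIV])
  also have "{f \<in> l2 UNIV. \<forall>u\<in>U. l2_inner f u = 0} = closed_forms E"
  proof (intro equalityI subsetI)
    fix f assume f: "f \<in> {f \<in> l2 UNIV. \<forall>u\<in>U. l2_inner f u = 0}"
    then have fl2: "f \<in> l2 UNIV" and fU: "\<And>u. u \<in> U \<Longrightarrow> l2_inner f u = 0" by auto
    have "f p = 0" if "p \<notin> oriented_edges E" for p
    proof -
      have "indicator {p} \<in> U" using that unfolding U_def by blast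
      from fU[OF this] show ?thesis by simp
    qed
    then have "f \<in> l2 (oriented_edges E)" using fl2 by (intro iffD2[OF l2_iff]) simp
    moreover have "f (y, x) = - f (x, y)" for x y
    proof -
      have "s x y \<in> U" unfolding U_def by blast
      from fU[OF this] have "f (x, y) + f (y, x) = 0" by (simp only: inner_s[OF fl2])
      then show ?thesis by (simp add: add_eq_0_iff)
    qed
    moreover have "l2_inner f z = 0" if "z \<in> finite_cycles E" for z
      using fU[of z] that by (simp add: U_def)
    ultimately show "f \<in> closed_forms E" unfolding closed_forms_def by blast
  next
    fix f assume f: "f \<in> closed_forms E"
    note fl2 = closed_formsD(1)[OF f]
    have "l2_inner f (s x y) = 0" for x y
      using inner_s[OF fl2, of x y] closed_formsD(3)[OF f, of y x] by simp
    moreover have "l2_inner f (indicator {p}) = 0" if "p \<notin> oriented_edges E" for p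
      using closed_formsD(2)[OF f that] by simp
    ultimately show "f \<in> {f \<in> l2 UNIV. \<forall>u\<in>U. l2_inner f u = 0}"
      using fl2 closed_formsD(4)[OF f] unfolding U_def by blast
  qed
  finally show ?thesis .
qed

lemma sum_neighbours_eq_l2_inner:
  assumes "finite {y. {x, y} \<in> E}"
  shows "(\<Sum>y | {x, y} \<in> E. c (x, y)) = l2_inner c (indicator ({x} \<times> {y. {x, y} \<in> E}))"
proof -
  have "sum c ({x} \<times> {y. {x, y} \<in> E}) = (\<Sum>v\<in>{x}. \<Sum>y | {x, y} \<in> E. c (v, y))"
    by (simp only: sum.cartesian_product case_prod_eta)
  then show ?thesis using assms by (subst l2_inner_indicator_set) auto
qed

lemma closed_subspace_harmonic_forms:
  assumes "\<And>x. finite {y. {x, y} \<in> E}"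
  shows "closed_subspace (harmonic_forms E)"
proof -
  have "harmonic_forms E =
    {f \<in> closed_forms E. \<forall>u\<in>range (\<lambda>x. indicator ({x} \<times> {y. {x, y} \<in> E})). l2_inner f u = 0}"
    unfolding set_eq_iff mem_Collect_eq harmonic_forms_iff sum_neighbours_eq_l2_inner[OF assms] by simp
  moreover have "range (\<lambda>x. indicator ({x} \<times> {y. {x, y} \<in> E}) :: _ \<Rightarrow> complex) \<subseteq> l2 UNIV"
    using assms by (auto intro!: indicator_set_in_l2)
  ultimately show ?thesis
    using closed_subspace_orthogonal[OF closed_subspace_closed_forms] by (simp only:)
qed

text \<open>
  A harmonic form vanishing on the edges that leave \<open>A\<close> restricts to a finite cycle inside \<open>A\<close>,
  to which it is orthogonal.
\<close>

lemma harmonic_form_vanishes: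
  assumes fin: "\<And>x. finite {y. {x, y} \<in> E}" and A: "finite A" and c: "c \<in> harmonic_forms E"
    and bd: "\<And>x y. {x, y} \<in> E \<Longrightarrow> x \<in> A \<Longrightarrow> y \<notin> A \<Longrightarrow> c (x, y) = 0" and x: "x \<in> A"
  shows "c (x, y) = 0"
proof -
  define z where "z p = (if p \<in> A \<times> A then c p else 0)" for p
  have cD: "c \<in> closed_forms E" and div: "\<And>x. (\<Sum>y | {x, y} \<in> E. c (x, y)) = 0"
    using c[unfolded harmonic_forms_iff] by auto
  have c0: "c (x, y) = 0" if "{x, y} \<notin> E" for x y
    using closed_formsD(2)[OF cD, of "(x, y)"] that by simp
  have z_fin: "finite {p. z p \<noteq> 0}"
    by (rule finite_subset[of _ "A \<times> A"]) (use A in \<open>auto simp: z_def\<close>)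
  have z: "z \<in> finite_cycles E"
  proof (rule finite_cyclesI[OF z_fin])
    show "z p = 0" if "p \<notin> oriented_edges E" for p
      using closed_formsD(2)[OF cD that] by (simp add: z_def)
    show "z (y, x) = - z (x, y)" for x y
      using closed_formsD(3)[OF cD, of y x] by (simp add: z_def)
    show "(\<Sum>y | {x, y} \<in> E. z (x, y)) = 0" for x
    proof (cases "x \<in> A")
      case True
      \<comment> \<open>At a vertex of \<open>A\<close>, \<open>z\<close> and \<open>c\<close>
        differ at most on edges leaving \<open>A\<close>, where \<open>c\<close> vanishes, so
        cutting off does not change the divergence. At other vertices \<open>z\<close> is
        zero.\<close>
      then have "(\<Sum>y | {x, y} \<in> E. z (x, y)) = (\<Sum>y | {x, y} \<in> E. c (x, y))"
        using bd by (intro sum.cong) (auto simp: z_def)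
      then show ?thesis using div by simp
    qed (simp add: z_def)
  qed
  \<comment> \<open>On the support of \<open>z\<close> the two functions \<open>z\<close> and
    \<open>c\<close> agree.\<close>
  have "l2_inner z z = l2_inner c z"
    unfolding l2_inner_def by (rule infsum_cong) (simp add: z_def)
  also have "\<dots> = 0" by (rule closed_formsD(4)[OF cD z])
  finally have "z p = 0" for p
    by (rule l2_inner_self_eq_0D[OF subsetD[OF finite_cycles_l2 z]])
  from this[of "(x, y)"] have "c (x, y) = 0" if "y \<in> A"
    using x that by (simp add: z_def)
  moreover have "c (x, y) = 0" if "y \<notin> A"
    using bd[OF _ x that] c0[of x y] by (cases "{x, y} \<in> E") simp_all
  ultimately show ?thesis by (cases "y \<in> A") simp_all
qed

lemma sum_harmonic_diagonal_le_boundary: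
  assumes fin: "\<And>x. finite {y. {x, y} \<in> E}" and A: "finite A"
  shows "(\<Sum>p | p \<in> oriented_edges E \<and> fst p \<in> A. Re (orth_proj (harmonic_forms E) (indicator {p}) p))
    \<le> card (edge_boundary E A)"
proof -
  have star: "finite {p. p \<in> oriented_edges E \<and> fst p \<in> A}"
    by (rule finite_subset[of _ "SIGMA x:A. {y. {x, y} \<in> E}"]) (use fin A in auto)
  \<comment> \<open>Each boundary edge is oriented outwards and so counted once; this gives the
    bound without a factor 2.\<close>
  define B where "B = {(x, y). {x, y} \<in> E \<and> x \<in> A \<and> y \<notin> A}"
  have B: "finite B" by (rule finite_subset[OF _ star]) (auto simp: B_def)
  have "(\<lambda>(x, y). {x, y}) ` B = edge_boundary E A"
    by (auto simp: B_def edge_boundary_def image_iff)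
  moreover have "inj_on (\<lambda>(x, y). {x, y}) B"
    by (rule inj_onI) (auto simp: B_def doubleton_eq_iff)
  ultimately have "card B = card (edge_boundary E A)"
    using card_image by fastforce
  moreover have "(\<Sum>p | p \<in> oriented_edges E \<and> fst p \<in> A. Re (orth_proj (harmonic_forms E) (indicator {p}) p))
      \<le> card B"
  proof (rule sum_orth_proj_diagonal_le_card[OF B star closed_subspace_harmonic_forms[OF fin]])
    fix v p assume v: "v \<in> harmonic_forms E" and 0: "\<And>b. b \<in> B \<Longrightarrow> v b = 0"
      and p: "p \<in> {p. p \<in> oriented_edges E \<and> fst p \<in> A}"
    have "v (fst p, snd p) = 0"
      by (rule harmonic_form_vanishes[OF fin A v]) (use 0 p in \<open>auto simp: B_def\<close>)
    then show "v p = 0" by simp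
  qed
  ultimately show ?thesis by simp
qed

section \<open>Closed forms are gradients\<close>

lemma grad_l2:
  assumes "grad (oriented_edges E) F \<in> l2 UNIV"
  shows "grad (oriented_edges E) F \<in> l2 (oriented_edges E)"
  using assms by (subst l2_iff) (auto simp: grad_def)

text \<open>Summation by parts: the differences of \<open>F\<close> are moved onto the divergence of
  the cycle, which is zero. The cycle involves finitely many vertices, so the terms with
  \<open>F\<close> at the two ends can be summed separately.\<close>

lemma grad_in_closed_forms:
  assumes fin: "\<And>x. finite {y. {x, y} \<in> E}" and F: "grad (oriented_edges E) F \<in> l2 UNIV"
  shows "grad (oriented_edges E) F \<in> closed_forms E"
proof -
  let ?c = "grad (oriented_edges E) F"
  have "l2_inner ?c z = 0" if z: "z \<in> finite_cycles E" for z
  proof -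
    define V where "V = fst ` {p. z p \<noteq> 0} \<union> snd ` {p. z p \<noteq> 0}"
    have V: "finite V" using finite_cyclesD(1)[OF z] by (simp add: V_def)
    have zV: "z (x, y) = 0" if "x \<notin> V \<or> y \<notin> V" for x y
      using that unfolding V_def by force
    have z0: "z (x, y) = 0" if "{x, y} \<notin> E" for x y
      using finite_cyclesD(2)[OF z, of "(x, y)"] that by simp
    have div: "(\<Sum>y\<in>V. z (x, y)) = 0" for x
    proof -
      have "(\<Sum>y\<in>V. z (x, y)) = (\<Sum>y | {x, y} \<in> E. z (x, y))"
        using V fin z0 zV by (intro sum.mono_neutral_cong) auto
      then show ?thesis using finite_cyclesD(4)[OF z] by simp
    qed
    then have div': "(\<Sum>y\<in>V. cnj (z (x, y))) = 0" for x
      by (simp only: cnj_sum[symmetric] complex_cnj_zero)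
    have "l2_inner ?c z = (\<Sum>p\<in>V \<times> V. ?c p * cnj (z p))"
      using V zV by (intro l2_inner_finite) auto
    also have "\<dots> = (\<Sum>(x, y)\<in>V \<times> V. F y * cnj (z (x, y)) - F x * cnj (z (x, y)))"
      using z0 by (intro sum.cong) (auto simp: grad_def algebra_simps)
    also have "\<dots> = (\<Sum>x\<in>V. \<Sum>y\<in>V. F y * cnj (z (x, y))) - (\<Sum>x\<in>V. \<Sum>y\<in>V. F x * cnj (z (x, y)))"
      by (simp only: sum.cartesian_product[symmetric] sum_subtractf)
    also have "(\<Sum>x\<in>V. \<Sum>y\<in>V. F x * cnj (z (x, y))) = 0"
      by (simp only: sum_distrib_left[symmetric] div' mult_zero_right sum.neutral_const)
    \<comment> \<open>Exchanging the sums and using antisymmetry turns the terms at the end of each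
      edge into terms at its start.\<close>
    also have "(\<Sum>x\<in>V. \<Sum>y\<in>V. F y * cnj (z (x, y))) = (\<Sum>y\<in>V. \<Sum>x\<in>V. F y * cnj (- z (y, x)))"
      by (subst sum.swap, intro sum.cong refl, subst finite_cyclesD(3)[OF z], rule refl)
    also have "\<dots> = 0"
      by (simp only: complex_cnj_minus sum_distrib_left[symmetric] sum_negf div' minus_zero
          mult_zero_right sum.neutral_const)
    finally show ?thesis by simp
  qed
  moreover have "?c (y, x) = - ?c (x, y)" for x y
    by (simp add: grad_def insert_commute[of y x])
  ultimately show ?thesis
    unfolding closed_forms_def mem_Collect_eq using grad_l2[OF F] by (intro conjI allI ballI)
qed

text \<open>An edge at \<open>v\<close> contributes through both orientations, and the gradient of
  the point mass is -1 on edges leaving \<open>v\<close>; hence the factor -2. This makes the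
  divergence at \<open>v\<close> an inner product, which adjoints and translations can
  handle.\<close>

lemma grad_indicator:
  assumes "\<And>x. finite {y. {x, y} \<in> E}"
  shows "grad (oriented_edges E) (indicator {v}) \<in> l2 UNIV"
    and "c \<in> closed_forms E \<Longrightarrow> l2_inner c (grad (oriented_edges E) (indicator {v})) =
      - 2 * (\<Sum>y | {v, y} \<in> E. c (v, y))"
proof -
  let ?N = "{y. {v, y} \<in> E}"
  have eq: "grad (oriented_edges E) (indicator {v}) = (\<lambda>p. indicator (?N \<times> {v}) p - indicator ({v} \<times> ?N) p)"
  proof
    fix p
    show "grad (oriented_edges E) (indicator {v}) p = indicator (?N \<times> {v}) p - indicator ({v} \<times> ?N) p"
      by (cases p) (auto simp: grad_def indicator_def insert_commute)
  qed
  have fin: "finite (?N \<times> {v})" "finite ({v} \<times> ?N)" using assms by auto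
  show "grad (oriented_edges E) (indicator {v}) \<in> l2 UNIV"
    unfolding eq by (intro l2_diff indicator_set_in_l2 fin)
  assume c: "c \<in> closed_forms E"
  note anti = closed_formsD(3)[OF c, where x = v] and cl2 = closed_formsD(1)[OF c]
  have "l2_inner c (grad (oriented_edges E) (indicator {v})) = sum c (?N \<times> {v}) - sum c ({v} \<times> ?N)"
    unfolding eq
    by (subst l2_inner_diff_right[OF indicator_set_in_l2[OF fin(1)] indicator_set_in_l2[OF fin(2)] cl2])
       (simp only: l2_inner_indicator_set[OF fin(1)] l2_inner_indicator_set[OF fin(2)])
  also have "\<dots> = - 2 * (\<Sum>y\<in>?N. c (v, y))"
  proof -
    have "sum c (?N \<times> {v}) = (\<Sum>y\<in>?N. \<Sum>u\<in>{v}. c (y, u))"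
      and "sum c ({v} \<times> ?N) = (\<Sum>u\<in>{v}. \<Sum>y\<in>?N. c (u, y))"
      by (simp_all only: sum.cartesian_product case_prod_eta)
    then show ?thesis by (simp add: anti sum_negf)
  qed
  finally show "l2_inner c (grad (oriented_edges E) (indicator {v})) = - 2 * (\<Sum>y\<in>?N. c (v, y))" .
qed

text \<open>A replacement for paths from \<open>v\<close> to \<open>w\<close>: concatenation becomes
  addition, reversal becomes negation, and a closed path becomes a finite cycle, without any
  bookkeeping of repeated vertices.\<close>

definition unit_flow :: "'v set set \<Rightarrow> 'v \<Rightarrow> 'v \<Rightarrow> ('v \<times> 'v \<Rightarrow> complex) \<Rightarrow> bool" where
  "unit_flow E v w \<theta> \<longleftrightarrow> finite {p. \<theta> p \<noteq> 0} \<and> (\<forall>p. p \<notin> oriented_edges E \<longrightarrow> \<theta> p = 0) \<and>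
     (\<forall>x y. \<theta> (y, x) = - \<theta> (x, y)) \<and>
     (\<forall>x. (\<Sum>y | {x, y} \<in> E. \<theta> (x, y)) = indicator {v} x - indicator {w} x)"

lemma unit_flowD:
  assumes "unit_flow E v w \<theta>"
  shows "finite {p. \<theta> p \<noteq> 0}" and "p \<notin> oriented_edges E \<Longrightarrow> \<theta> p = 0" and "\<theta> (y, x) = - \<theta> (x, y)"
    and "(\<Sum>y | {x, y} \<in> E. \<theta> (x, y)) = indicator {v} x - indicator {w} x"
  using assms unfolding unit_flow_def by blast+

lemma unit_flowI:
  assumes "finite {p. \<theta> p \<noteq> 0}" and "\<And>p. p \<notin> oriented_edges E \<Longrightarrow> \<theta> p = 0"
    and "\<And>x y. \<theta> (y, x) = - \<theta> (x, y)"
    and "\<And>x. (\<Sum>y | {x, y} \<in> E. \<theta> (x, y)) = indicator {v} x - indicator {w} x"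
  shows "unit_flow E v w \<theta>"
  using assms unfolding unit_flow_def by blast

lemma unit_flow_refl: "unit_flow E v v (\<lambda>_. 0)"
  by (simp add: unit_flow_def)

lemma unit_flow_trans:
  assumes "unit_flow E u v \<theta>" and "unit_flow E v w \<eta>"
  shows "unit_flow E u w (\<lambda>p. \<theta> p + \<eta> p)"
proof (rule unit_flowI)
  show "finite {p. \<theta> p + \<eta> p \<noteq> 0}"
    by (rule finite_subset[of _ "{p. \<theta> p \<noteq> 0} \<union> {p. \<eta> p \<noteq> 0}"])
       (use unit_flowD(1)[OF assms(1)] unit_flowD(1)[OF assms(2)] in auto)
  show "\<theta> (y, x) + \<eta> (y, x) = - (\<theta> (x, y) + \<eta> (x, y))" for x y
    using unit_flowD(3)[OF assms(1), of y x] unit_flowD(3)[OF assms(2), of y x] by simp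
qed (use unit_flowD(2,4)[OF assms(1)] unit_flowD(2,4)[OF assms(2)] in \<open>auto simp: sum.distrib\<close>)

lemma unit_flow_reverse:
  assumes "unit_flow E u v \<theta>"
  shows "unit_flow E v u (\<lambda>p. - \<theta> p)"
proof (rule unit_flowI)
  show "- \<theta> (y, x) = - (- \<theta> (x, y))" for x y
    using unit_flowD(3)[OF assms, of y x] by simp
qed (use unit_flowD(1,2,4)[OF assms] in \<open>auto simp: sum_negf\<close>)

lemma unit_flow_edge:
  assumes fin: "\<And>x. finite {y. {x, y} \<in> E}" and e: "{x, y} \<in> E"
  shows "unit_flow E x y (\<lambda>p. indicator {(x, y)} p - indicator {(y, x)} p)"
proof -
  have e': "{y, x} \<in> E" using e by (simp add: insert_commute)
  have 1: "finite {p. indicator {(x, y)} p - indicator {(y, x)} p \<noteq> (0 :: complex)}"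
    by (rule finite_subset[of _ "{(x, y), (y, x)}"]) (auto simp: indicator_def)
  have 2: "(\<Sum>w | {v, w} \<in> E. indicator {(x, y)} (v, w) - indicator {(y, x)} (v, w)) =
      (indicator {x} v - indicator {y} v :: complex)" for v
  proof -
    have "(\<Sum>w | {v, w} \<in> E. indicator {(a, b)} (v, w)) = (indicator {a} v :: complex)"
      if "{a, b} \<in> E" for a b
    proof -
      have "(\<Sum>w | {v, w} \<in> E. indicator {(a, b)} (v, w)) =
          (\<Sum>w | {v, w} \<in> E. if w = b then indicator {a} v else (0 :: complex))"
        by (rule sum.cong) (auto simp: indicator_def)
      also have "\<dots> = indicator {a} v"
        using fin[of v] that by (auto simp: sum.delta indicator_def)
      finally show ?thesis .
    qed
    from this[OF e] this[OF e'] show ?thesis by (simp only: sum_subtractf)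
  qed
  show ?thesis
  proof (rule unit_flowI[OF 1 _ _ 2])
    show "indicator {(x, y)} p - indicator {(y, x)} p = (0 :: complex)" if "p \<notin> oriented_edges E" for p
    proof -
      have "p \<noteq> (x, y)" and "p \<noteq> (y, x)" using that e e' by auto
      then show ?thesis by simp
    qed
    show "indicator {(x, y)} (b, a) - indicator {(y, x)} (b, a) =
        - (indicator {(x, y)} (a, b) - indicator {(y, x)} (a, b) :: complex)" for a b
    proof -
      have "indicator {(x, y)} (b, a) = (indicator {(y, x)} (a, b) :: complex)" for x y
        by (cases "b = x"; cases "a = y") simp_all
      then show ?thesis by (simp only: minus_diff_eq)
    qed
  qed
qed

lemma unit_flow_cycle:
  assumes "unit_flow E v v z"
  shows "z \<in> finite_cycles E"
proof (rule finite_cyclesI)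
  show "z (y, x) = - z (x, y)" for x y by (rule unit_flowD(3)[OF assms])
qed (use unit_flowD(1,2,4)[OF assms] in simp_all)

text \<open>Integration along flows from a base point. Flows are asked for only at extremities of
  edges, since the vertex type may contain points outside the graph.\<close>

lemma closed_form_is_grad:
  assumes fin: "\<And>x. finite {y. {x, y} \<in> E}"
    and conn: "\<And>x y. {x, y} \<in> E \<Longrightarrow> \<exists>\<theta>. unit_flow E v\<^sub>0 x \<theta>" and c: "c \<in> closed_forms E"
  obtains F where "c = grad (oriented_edges E) F"
proof -
  obtain \<theta> where \<theta>: "\<And>x y. {x, y} \<in> E \<Longrightarrow> unit_flow E v\<^sub>0 x (\<theta> x)"
    using conn by metis
  note cl2 = closed_formsD(1)[OF c]
  \<comment> \<open>The inner product counts each edge of the flow in both orientations, so it is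
    halved.\<close>
  define F where "F x = l2_inner c (\<theta> x) / 2" for x
  have "c (x, y) = F y - F x" if e: "{x, y} \<in> E" for x y
  proof -
    let ?e = "\<lambda>p. indicator {(x, y)} p - indicator {(y, x)} p :: complex"
    have flow: "unit_flow E v\<^sub>0 x (\<theta> x)" "unit_flow E v\<^sub>0 y (\<theta> y)"
      using \<theta>[of x y] \<theta>[of y x] e by (auto simp: insert_commute)
    then have \<theta>l2: "\<theta> x \<in> l2 UNIV" "\<theta> y \<in> l2 UNIV"
      by (auto intro: l2_finite_support unit_flowD(1))
    have el2: "?e \<in> l2 UNIV" by (intro l2_diff indicator_in_l2)
    \<comment> \<open>Going to \<open>x\<close>, along the edge to \<open>y\<close>, and back to the
      base point closes up to a finite cycle, to which \<open>c\<close> is orthogonal.\<close>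
    have "unit_flow E v\<^sub>0 v\<^sub>0 (\<lambda>p. (\<theta> x p + ?e p) + - \<theta> y p)"
      by (rule unit_flow_trans[OF unit_flow_trans[OF flow(1) unit_flow_edge[OF fin e]]
            unit_flow_reverse[OF flow(2)]])
    then have "(\<lambda>p. (\<theta> x p + ?e p) - \<theta> y p) \<in> finite_cycles E"
      using unit_flow_cycle by fastforce
    then have "0 = l2_inner c (\<lambda>p. (\<theta> x p + ?e p) - \<theta> y p)"
      using closed_formsD(4)[OF c] by simp
    also have "\<dots> = l2_inner c (\<lambda>p. \<theta> x p + ?e p) - l2_inner c (\<theta> y)"
      by (intro l2_inner_diff_right l2_add \<theta>l2 el2 cl2)
    also have "l2_inner c (\<lambda>p. \<theta> x p + ?e p) = l2_inner c (\<theta> x) + l2_inner c ?e"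
      using l2_inner_lincomb_right[OF \<theta>l2(1) el2 cl2, of 1] by simp
    also have "l2_inner c ?e = c (x, y) - c (y, x)"
      using l2_inner_diff_right[OF indicator_in_l2 indicator_in_l2 cl2, of "(x, y)" "(y, x)"] by simp
    also have "c (y, x) = - c (x, y)" by (rule closed_formsD(3)[OF c])
    finally show ?thesis by (simp add: F_def field_simps)
  qed
  moreover have "c (x, y) = 0" if "{x, y} \<notin> E" for x y
    using closed_formsD(2)[OF c, of "(x, y)"] that by simp
  ultimately have "c = grad (oriented_edges E) F"
    by (auto simp: grad_def fun_eq_iff)
  then show thesis by (rule that)
qed

section \<open>Cayley graphs\<close>

lemma l2_sum:
  assumes "finite K" and "\<And>t. t \<in> K \<Longrightarrow> f t \<in> l2 UNIV \<and> l2_norm (f t) \<le> C t * N"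
  shows "(\<lambda>x. \<Sum>t\<in>K. f t x) \<in> l2 UNIV \<and> l2_norm (\<lambda>x. \<Sum>t\<in>K. f t x) \<le> (\<Sum>t\<in>K. C t) * N"
  using assms
proof (induction K rule: finite_induct)
  case empty
  then show ?case by simp
next
  case (insert t K)
  have t: "f t \<in> l2 UNIV" "l2_norm (f t) \<le> C t * N"
    using insert.prems[of t] by simp_all
  have K: "(\<lambda>x. \<Sum>t\<in>K. f t x) \<in> l2 UNIV" "l2_norm (\<lambda>x. \<Sum>t\<in>K. f t x) \<le> (\<Sum>t\<in>K. C t) * N"
    using insert.IH insert.prems by simp_all
  show ?case
    using l2_add[OF t(1) K(1)] t(2) K(2) by (simp add: insert.hyps distrib_right)
qed

text \<open>
  The adjoint of the map sending the gradient of \<open>F\<close> along the edges of \<open>S\<close> to the gradient of the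
  same function along the edges of \<open>T\<close>.
\<close>

definition transfer :: "('a, 'b) monoid_scheme \<Rightarrow> 'a set \<Rightarrow> 'a set \<Rightarrow> ('a \<times> 'a \<Rightarrow> complex) \<Rightarrow> 'a \<times> 'a \<Rightarrow> complex" where
  "transfer G S T h = (THE c. c \<in> closed_forms (cayley_edges G S) \<and>
     (\<forall>F. grad (oriented_edges (cayley_edges G S)) F \<in> l2 UNIV \<longrightarrow>
       l2_inner (grad (oriented_edges (cayley_edges G S)) F) c =
       l2_inner (grad (oriented_edges (cayley_edges G T)) F) h))"

context group
begin

abbreviation cayley_pairs :: "'a set \<Rightarrow> ('a \<times> 'a) set" where
  "cayley_pairs S \<equiv> oriented_edges (cayley_edges G S)"

lemma finite_generating_setD:
  assumes "finite_generating_set G S"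
  shows "finite S" and "S \<subseteq> carrier G" and "generate G S = carrier G"
  using assms by (simp_all add: finite_generating_set_def)

lemma cayley_edges_iff:
  assumes S: "S \<subseteq> carrier G"
  shows "{x, y} \<in> cayley_edges G S \<longleftrightarrow>
    x \<in> carrier G \<and> y \<in> carrier G \<and> x \<noteq> y \<and> (inv x \<otimes> y \<in> S \<or> inv y \<otimes> x \<in> S)"
    (is "?L \<longleftrightarrow> ?R")
proof
  assume ?L
  then obtain g s where e: "{x, y} = {g, g \<otimes> s}" and gs: "g \<in> carrier G" "s \<in> S" "g \<otimes> s \<noteq> g"
    unfolding cayley_edges_def by blast
  have s: "s \<in> carrier G" and "inv g \<otimes> (g \<otimes> s) = s"
    using S gs by (auto simp: m_assoc[symmetric])
  then show ?R using e gs by (auto simp: doubleton_eq_iff)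
next
  assume R: ?R
  have "{a, b} \<in> cayley_edges G S"
    if "a \<in> carrier G" "b \<in> carrier G" "a \<noteq> b" "inv a \<otimes> b \<in> S" for a b
  proof -
    have "a \<otimes> (inv a \<otimes> b) = b" using that by (simp add: m_assoc[symmetric])
    then have "a \<otimes> (inv a \<otimes> b) \<noteq> a" and "{a, b} = {a, a \<otimes> (inv a \<otimes> b)}" using that by simp_all
    then show ?thesis using that unfolding cayley_edges_def by blast
  qed
  from this[of x y] this[of y x] show ?L using R by (auto simp: insert_commute)
qed

lemma finite_cayley_neighbours:
  assumes "finite_generating_set G S"
  shows "finite {y. {x, y} \<in> cayley_edges G S}"
proof (rule finite_subset)
  note S = finite_generating_setD(1,2)[OF assms]
  show "finite ((\<lambda>s. x \<otimes> s) ` S \<union> (\<lambda>s. x \<otimes> inv s) ` S)" using S by simp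
  show "{y. {x, y} \<in> cayley_edges G S} \<subseteq> (\<lambda>s. x \<otimes> s) ` S \<union> (\<lambda>s. x \<otimes> inv s) ` S"
  proof
    fix y assume "y \<in> {y. {x, y} \<in> cayley_edges G S}"
    then have xy: "x \<in> carrier G" "y \<in> carrier G" and s: "inv x \<otimes> y \<in> S \<or> inv y \<otimes> x \<in> S"
      using cayley_edges_iff[OF S(2)] by auto
    have "y = x \<otimes> (inv x \<otimes> y)" and "y = x \<otimes> inv (inv y \<otimes> x)"
      using xy by (simp_all add: m_assoc[symmetric] inv_mult_group)
    then show "y \<in> (\<lambda>s. x \<otimes> s) ` S \<union> (\<lambda>s. x \<otimes> inv s) ` S" using s by blast
  qed
qed

lemma left_invariant_cayley_pairs:
  assumes "S \<subseteq> carrier G"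
  shows "left_invariant G (cayley_pairs S)"
proof -
  have "inv (g \<otimes> x) \<otimes> (g \<otimes> y) = inv x \<otimes> y" if "g \<in> carrier G" "x \<in> carrier G" "y \<in> carrier G" for g x y
  proof -
    have "inv (g \<otimes> x) \<otimes> (g \<otimes> y) = inv x \<otimes> ((inv g \<otimes> g) \<otimes> y)"
      using that by (simp only: inv_mult_group m_assoc inv_closed m_closed)
    then show ?thesis using that by simp
  qed
  then show ?thesis
    unfolding left_invariant_def by (auto simp: cayley_edges_iff[OF assms] pair_act_def)
qed

lemma finite_cayley_base:
  assumes "finite_generating_set G S"
  shows "finite {e \<in> cayley_pairs S. fst e = \<one>}"
  by (rule finite_subset[of _ "{\<one>} \<times> {y. {\<one>, y} \<in> cayley_edges G S}"])
     (use finite_cayley_neighbours[OF assms] in auto)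

text \<open>Induction on a word for \<open>g\<close>; the starting point is arbitrary because the
  second factor of a product starts where the first one ends.\<close>

lemma cayley_unit_flow:
  assumes S: "finite_generating_set G S" and g: "g \<in> generate G S" and x: "x \<in> carrier G"
  shows "\<exists>\<theta>. unit_flow (cayley_edges G S) x (x \<otimes> g) \<theta>"
proof -
  note S' = finite_generating_setD(2)[OF S]
  \<comment> \<open>The case \<open>x = y\<close> arises when a generator is the neutral element,
    for which the graph has no loop.\<close>
  have step: "\<exists>\<theta>. unit_flow (cayley_edges G S) x y \<theta>" if "x = y \<or> {x, y} \<in> cayley_edges G S" for x y
    using that
  proof
    assume "x = y"
    then show ?thesis by (intro exI[of _ "\<lambda>_. 0"]) (simp add: unit_flow_refl)
  next
    assume "{x, y} \<in> cayley_edges G S"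
    from unit_flow_edge[OF finite_cayley_neighbours[OF S] this]
    show ?thesis by (rule exI[of "unit_flow (cayley_edges G S) x y"])
  qed
  show ?thesis
    using g x
  proof (induction g arbitrary: x rule: generate.induct)
    case one
    then show ?case by (intro step) simp
  next
    case (incl h)
    then have h: "h \<in> carrier G" using S' by blast
    then have "inv x \<otimes> (x \<otimes> h) = h"
      using incl.prems by (simp add: m_assoc[symmetric])
    then have "x = x \<otimes> h \<or> {x, x \<otimes> h} \<in> cayley_edges G S"
      using incl h by (simp add: cayley_edges_iff[OF S'])
    then show ?case by (rule step)
  next
    case (inv h)
    then have h: "h \<in> carrier G" using S' by blast
    then have "inv (x \<otimes> inv h) \<otimes> x = h"
      using inv.prems by (simp add: inv_mult_group m_assoc)
    then have "x = x \<otimes> inv h \<or> {x, x \<otimes> inv h} \<in> cayley_edges G S"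
      using inv h by (simp add: cayley_edges_iff[OF S'])
    then show ?case by (rule step)
  next
    case (eng h1 h2)
    have h: "h1 \<in> carrier G" "h2 \<in> carrier G"
      using eng.hyps generate_in_carrier[OF S'] by auto
    obtain \<theta> where \<theta>: "unit_flow (cayley_edges G S) x (x \<otimes> h1) \<theta>"
      using eng.IH(1)[OF eng.prems] by (rule exE)
    obtain \<eta> where \<eta>: "unit_flow (cayley_edges G S) (x \<otimes> h1) (x \<otimes> h1 \<otimes> h2) \<eta>"
      using eng.IH(2)[OF m_closed[OF eng.prems h(1)]] by (rule exE)
    from unit_flow_trans[OF \<theta> \<eta>] show ?case
      unfolding m_assoc[OF eng.prems h] by (rule exI[of "unit_flow (cayley_edges G S) x (x \<otimes> (h1 \<otimes> h2))"])
  qed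
qed

lemma cayley_closed_form_is_grad:
  assumes S: "finite_generating_set G S" and c: "c \<in> closed_forms (cayley_edges G S)"
  obtains F where "c = grad (cayley_pairs S) F"
proof (rule closed_form_is_grad[OF finite_cayley_neighbours[OF S] _ c])
  fix x y assume "{x, y} \<in> cayley_edges G S"
  then have "x \<in> carrier G" using cayley_edges_iff[OF finite_generating_setD(2)[OF S]] by blast
  then show "\<exists>\<theta>. unit_flow (cayley_edges G S) \<one> x \<theta>"
    using cayley_unit_flow[OF S, of x \<one>] finite_generating_setD(3)[OF S] by simp
qed (rule that)

section \<open>Translates of closed and harmonic forms\<close>

lemma translate_grad:
  assumes X: "left_invariant G X" and g: "g \<in> carrier G"
  shows "translate G g (grad X F) = grad X (\<lambda>x. F (g \<otimes> x))"
proof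
  fix p
  show "translate G g (grad X F) p = grad X (\<lambda>x. F (g \<otimes> x)) p"
  proof (cases "p \<in> carrier G \<times> carrier G")
    case True
    from left_invariant_iff[OF X g True] show ?thesis
      using True by (simp add: translate_def grad_def del: mem_Times_iff) (simp add: pair_act_def)
  next
    case False
    then have "p \<notin> X" using left_invariantD(1)[OF X] by blast
    with False show ?thesis by (simp add: translate_def grad_def del: mem_Times_iff)
  qed
qed

text \<open>A translate of a gradient is the gradient of the translated potential, so describing
  closed forms as gradients avoids translating finite cycles.\<close>

lemma translation_invariant_closed_forms:
  assumes S: "finite_generating_set G S"
  shows "translation_invariant G (closed_forms (cayley_edges G S))"
  unfolding translation_invariant_def
proof (intro ballI)
  fix g c assume g: "g \<in> carrier G" and c: "c \<in> closed_forms (cayley_edges G S)"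
  note X = left_invariant_cayley_pairs[OF finite_generating_setD(2)[OF S]]
  obtain F where F: "c = grad (cayley_pairs S) F" by (rule cayley_closed_form_is_grad[OF S c])
  have "translate G g c \<in> l2 UNIV"
    using l2_subset_UNIV[OF translate_l2(1)[OF X g subsetD[OF closed_forms_l2 c]]] .
  then show "translate G g c \<in> closed_forms (cayley_edges G S)"
    unfolding F translate_grad[OF X g]
    by (rule grad_in_closed_forms[OF finite_cayley_neighbours[OF S]])
qed

text \<open>Pairing with the gradient of the point mass at \<open>v\<close> computes the divergence
  of the translate at \<open>v\<close>; moving the translation to the other side gives the
  divergence of \<open>c\<close> at \<open>g \<otimes> v\<close>.\<close>

lemma translation_invariant_harmonic_forms:
  assumes S: "finite_generating_set G S"
  shows "translation_invariant G (harmonic_forms (cayley_edges G S))"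
  unfolding translation_invariant_def
proof (intro ballI)
  let ?E = "cayley_edges G S" and ?X = "cayley_pairs S"
  fix g c assume g: "g \<in> carrier G" and c: "c \<in> harmonic_forms ?E"
  note S' = finite_generating_setD(2)[OF S]
  note X = left_invariant_cayley_pairs[OF S']
  note ind = grad_indicator[OF finite_cayley_neighbours[OF S]]
  have cD: "c \<in> closed_forms ?E" using c harmonic_forms_subset by blast
  then have tD: "translate G g c \<in> closed_forms ?E"
    using translation_invariant_closed_forms[OF S] g unfolding translation_invariant_def by blast
  have "(\<Sum>y | {v, y} \<in> ?E. translate G g c (v, y)) = 0" for v
  proof (cases "v \<in> carrier G")
    case True
    have "grad ?X (\<lambda>x. indicator {v} (inv g \<otimes> x)) = grad ?X (indicator {g \<otimes> v})"
    proof -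
      have "indicator {v} (inv g \<otimes> x) = (indicator {g \<otimes> v} x :: complex)" if "x \<in> carrier G" for x
      proof -
        have "inv g \<otimes> x = v \<longleftrightarrow> x = g \<otimes> v" using inv_solve_left[OF True g that] by auto
        then show ?thesis by (cases "inv g \<otimes> x = v") simp_all
      qed
      then show ?thesis
        using left_invariantD(1)[OF X] by (auto simp: grad_def fun_eq_iff)
    qed
    then have "l2_inner (translate G g c) (grad ?X (indicator {v})) = l2_inner c (grad ?X (indicator {g \<otimes> v}))"
      using l2_inner_translate_left[OF X g subsetD[OF closed_forms_l2 cD] grad_l2[OF ind(1)]]
        translate_grad[OF X inv_closed[OF g]] by simp
    also have "\<dots> = 0" using ind(2)[OF cD] c[unfolded harmonic_forms_iff] by simp
    finally show ?thesis using ind(2)[OF tD, of v] by simp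
  next
    case False
    then have "{y. {v, y} \<in> ?E} = {}" using cayley_edges_iff[OF S'] by blast
    then show ?thesis by simp
  qed
  then show "translate G g c \<in> harmonic_forms ?E"
    using tD by (simp add: harmonic_forms_iff)
qed

text \<open>For \<open>g\<close> in \<open>S\<close> this is the gradient along the edges labelled
  \<open>g\<close>, read as a function of their starting point; an arbitrary \<open>g\<close> stands
  for a word in the generators.\<close>

definition shift_diff :: "'a \<Rightarrow> ('a \<Rightarrow> complex) \<Rightarrow> 'a \<Rightarrow> complex" where
  "shift_diff g F = (\<lambda>x. if x \<in> carrier G then F (x \<otimes> g) - F x else 0)"

text \<open>Differences telescope along a word. A generator or an inverse of one costs the constant
  1, and constants add under products, so \<open>C\<close> may be thought of as the length of a word
  for \<open>g\<close>.\<close>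

lemma shift_diff_bounded:
  assumes S: "finite_generating_set G S" and g: "g \<in> generate G S"
  shows "\<exists>C. \<forall>F. grad (cayley_pairs S) F \<in> l2 UNIV \<longrightarrow>
    shift_diff g F \<in> l2 UNIV \<and> l2_norm (shift_diff g F) \<le> C * l2_norm (grad (cayley_pairs S) F)"
  using g
proof (induction g rule: generate.induct)
  note S' = finite_generating_setD(2)[OF S]
  let ?D = "\<lambda>F. grad (cayley_pairs S) F"
  have step: "shift_diff h F \<in> l2 UNIV \<and> l2_norm (shift_diff h F) \<le> 1 * l2_norm (?D F)"
    if D: "?D F \<in> l2 UNIV" and h: "h \<in> carrier G"
      and edge: "\<And>x. x \<in> carrier G \<Longrightarrow> x \<otimes> h \<noteq> x \<Longrightarrow> {x, x \<otimes> h} \<in> cayley_edges G S" for h F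
  proof -
    have inj: "inj_on (\<lambda>x. (x, x \<otimes> h)) {x. shift_diff h F x \<noteq> 0}" by (rule inj_onI) simp
    have le: "cmod (shift_diff h F x) \<le> cmod (?D F (x, x \<otimes> h))" if "shift_diff h F x \<noteq> 0" for x
    proof -
      have x: "x \<in> carrier G" and ne: "F (x \<otimes> h) \<noteq> F x"
        using that by (auto simp: shift_diff_def split: if_splits)
      then have "x \<otimes> h \<noteq> x" by metis
      from edge[OF x this] show ?thesis using x by (simp add: shift_diff_def grad_def)
    qed
    show ?thesis
      using l2_reindex(1)[OF D inj le] l2_reindex(2)[OF D inj le] by simp
  qed
  {
    case one
    have "shift_diff \<one> F = (\<lambda>_. 0)" for F by (auto simp: shift_diff_def)
    then show ?case by (intro exI[of _ 0]) simp
  next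
    case (incl h)
    then have h: "h \<in> carrier G" using S' by blast
    have "{x, x \<otimes> h} \<in> cayley_edges G S" if "x \<in> carrier G" "x \<otimes> h \<noteq> x" for x
    proof -
      have "inv x \<otimes> (x \<otimes> h) = h" using that h by (simp add: m_assoc[symmetric])
      then show ?thesis using incl that h by (auto simp: cayley_edges_iff[OF S'])
    qed
    from step[OF _ h this] show ?case by (intro exI[of _ 1] allI impI)
  next
    case (inv h)
    then have h: "h \<in> carrier G" using S' by blast
    have "{x, x \<otimes> inv h} \<in> cayley_edges G S" if "x \<in> carrier G" "x \<otimes> inv h \<noteq> x" for x
    proof -
      have "inv (x \<otimes> inv h) \<otimes> x = h" using that h by (simp add: inv_mult_group m_assoc)
      then show ?thesis using inv that h by (auto simp: cayley_edges_iff[OF S'])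
    qed
    from step[OF _ inv_closed[OF h] this] show ?case by (intro exI[of _ 1] allI impI)
  next
    case (eng h1 h2)
    have h: "h1 \<in> carrier G" "h2 \<in> carrier G"
      using eng generate_in_carrier[OF S'] by auto
    obtain C1 where C1: "\<forall>F. ?D F \<in> l2 UNIV \<longrightarrow>
        shift_diff h1 F \<in> l2 UNIV \<and> l2_norm (shift_diff h1 F) \<le> C1 * l2_norm (?D F)"
      using eng.IH(1) by (rule exE)
    obtain C2 where C2: "\<forall>F. ?D F \<in> l2 UNIV \<longrightarrow>
        shift_diff h2 F \<in> l2 UNIV \<and> l2_norm (shift_diff h2 F) \<le> C2 * l2_norm (?D F)"
      using eng.IH(2) by (rule exE)
    note C1 = C1[rule_format] and C2 = C2[rule_format]
    have "shift_diff (h1 \<otimes> h2) F \<in> l2 UNIV \<and> l2_norm (shift_diff (h1 \<otimes> h2) F) \<le> (C1 + C2) * l2_norm (?D F)"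
      if D: "?D F \<in> l2 UNIV" for F
    proof -
      \<comment> \<open>The second half of the path from \<open>x\<close> to
        \<open>x \<otimes> (h1 \<otimes> h2)\<close>: the \<open>h2\<close>-difference read at
        \<open>x \<otimes> h1\<close>. Right translation by \<open>h1\<close> is injective, so its
        norm does not grow.\<close>
      define f where "f x = (if x \<in> carrier G then shift_diff h2 F (x \<otimes> h1) else 0)" for x
      have "inj_on (\<lambda>x. x \<otimes> h1) {x. f x \<noteq> 0}"
        using h by (intro inj_onI) (auto simp: f_def split: if_splits)
      note f = l2_reindex[OF conjunct1[OF C2[OF D]] this]
      have fl2: "f \<in> l2 UNIV" "l2_norm f \<le> l2_norm (shift_diff h2 F)"
        by (rule f, simp add: f_def)+
      have eq: "shift_diff (h1 \<otimes> h2) F = (\<lambda>x. shift_diff h1 F x + f x)"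
        using h by (auto simp: shift_diff_def f_def m_assoc)
      have "shift_diff h1 F \<in> l2 UNIV" using C1[OF D] by blast
      from l2_add[OF this fl2(1)] show ?thesis
        using C1[OF D] C2[OF D] fl2(2) unfolding eq distrib_right by linarith
    qed
    then show ?case by (intro exI[of _ "C1 + C2"] allI impI)
  }
qed

text \<open>
  Every element is a word in \<open>S\<close>, and right translation preserves the \<open>\<ell>\<^sup>2\<close>-norm, so gradients
  with respect to different finite generating sets have comparable norms.
\<close>

lemma grad_comparison:
  assumes S: "finite_generating_set G S" and T: "finite_generating_set G T"
  obtains C where "\<And>F. grad (cayley_pairs S) F \<in> l2 UNIV \<Longrightarrow> grad (cayley_pairs T) F \<in> l2 UNIV"
    and "\<And>F. grad (cayley_pairs S) F \<in> l2 UNIV \<Longrightarrow>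
      l2_norm (grad (cayley_pairs T) F) \<le> C * l2_norm (grad (cayley_pairs S) F)"
proof -
  let ?DS = "grad (cayley_pairs S)" and ?DT = "grad (cayley_pairs T)"
  \<comment> \<open>The elements of \<open>T\<close> and their inverses, without the neutral
    element. With these labels each oriented edge \<open>(x, y)\<close> has exactly one label,
    \<open>inv x \<otimes> y\<close>.\<close>
  define K where "K = {t. {\<one>, t} \<in> cayley_edges G T}"
  have K: "finite K" unfolding K_def by (rule finite_cayley_neighbours[OF T])
  note T' = finite_generating_setD(2)[OF T]
  note X = left_invariant_cayley_pairs[OF T']
  have KC: "K \<subseteq> carrier G" unfolding K_def using cayley_edges_iff[OF T'] by blast
  have KT: "inv x \<otimes> y \<in> K \<longleftrightarrow> (x, y) \<in> cayley_pairs T" if "x \<in> carrier G" "y \<in> carrier G" for x y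
    using left_invariant_iff[OF X that(1), of "(\<one>, inv x \<otimes> y)"] that
    by (simp add: K_def pair_act_def m_assoc[symmetric])
  have "\<forall>t\<in>K. \<exists>C. \<forall>F. ?DS F \<in> l2 UNIV \<longrightarrow>
      shift_diff t F \<in> l2 UNIV \<and> l2_norm (shift_diff t F) \<le> C * l2_norm (?DS F)"
    using shift_diff_bounded[OF S] KC finite_generating_setD(3)[OF S] by blast
  then obtain C where C: "\<And>t F. t \<in> K \<Longrightarrow> ?DS F \<in> l2 UNIV \<Longrightarrow>
      shift_diff t F \<in> l2 UNIV \<and> l2_norm (shift_diff t F) \<le> C t * l2_norm (?DS F)"
    by (auto dest!: bchoice)
  have main: "?DT F \<in> l2 UNIV \<and> l2_norm (?DT F) \<le> (\<Sum>t\<in>K. C t) * l2_norm (?DS F)"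
    if D: "?DS F \<in> l2 UNIV" for F
  proof -
    \<comment> \<open>The part of the \<open>T\<close>-gradient carried by the edges labelled
      \<open>t\<close>; by uniqueness of the labels these parts add up to the whole
      gradient.\<close>
    define f where "f t p = (if snd p = fst p \<otimes> t then shift_diff t F (fst p) else 0)" for t p
    have "f t \<in> l2 UNIV \<and> l2_norm (f t) \<le> C t * l2_norm (?DS F)" if t: "t \<in> K" for t
    proof -
      have inj: "inj_on fst {p. f t p \<noteq> 0}"
        by (rule inj_onI) (auto simp: f_def prod_eq_iff split: if_splits)
      have le: "cmod (f t p) \<le> cmod (shift_diff t F (fst p))" for p by (simp add: f_def)
      have "f t \<in> l2 UNIV" and "l2_norm (f t) \<le> l2_norm (shift_diff t F)"
        using l2_reindex[OF conjunct1[OF C[OF t D]] inj le] by blast+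
      then show ?thesis using C[OF t D] by linarith
    qed
    from l2_sum[OF K this] have sum: "(\<lambda>p. \<Sum>t\<in>K. f t p) \<in> l2 UNIV \<and>
        l2_norm (\<lambda>p. \<Sum>t\<in>K. f t p) \<le> (\<Sum>t\<in>K. C t) * l2_norm (?DS F)" .
    have "?DT F (x, y) = (\<Sum>t\<in>K. f t (x, y))" for x y
    proof (cases "x \<in> carrier G \<and> y \<in> carrier G")
      case True
      have "y = x \<otimes> t \<longleftrightarrow> t = inv x \<otimes> y" if "t \<in> K" for t
        using inv_solve_left[of t x y] subsetD[OF KC that] True by simp
      then have "(\<Sum>t\<in>K. f t (x, y)) = (\<Sum>t\<in>K. if t = inv x \<otimes> y then shift_diff t F x else 0)"
        by (intro sum.cong) (auto simp: f_def)
      also have "\<dots> = (if (x, y) \<in> cayley_pairs T then shift_diff (inv x \<otimes> y) F x else 0)"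
        using K KT True by simp
      also have "\<dots> = ?DT F (x, y)"
        using True by (simp add: grad_def shift_diff_def m_assoc[symmetric])
      finally show ?thesis by simp
    next
      case False
      have "f t (x, y) = 0" if "t \<in> K" for t
        using False KC that by (auto simp: f_def shift_diff_def)
      moreover have "(x, y) \<notin> cayley_pairs T" using False left_invariantD(1)[OF X] by blast
      ultimately show ?thesis by (simp add: grad_def)
    qed
    then have "?DT F = (\<lambda>p. \<Sum>t\<in>K. f t p)" by (simp add: fun_eq_iff)
    with sum show ?thesis by simp
  qed
  show thesis by (rule that[of "\<Sum>t\<in>K. C t"]) (use main in auto)
qed

section \<open>Independence of the generating set\<close>

lemma grad_lincomb: "grad X (\<lambda>x. F x + a * F' x) = (\<lambda>p. grad X F p + a * grad X F' p)"
  by (auto simp: grad_def algebra_simps)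

text \<open>The difference of two candidates is closed, hence itself a square-summable gradient, and
  can be tested against itself.\<close>

lemma transfer_unique:
  assumes S: "finite_generating_set G S"
    and c: "c \<in> closed_forms (cayley_edges G S)" "c' \<in> closed_forms (cayley_edges G S)"
    and eq: "\<And>F. grad (cayley_pairs S) F \<in> l2 UNIV \<Longrightarrow>
      l2_inner (grad (cayley_pairs S) F) c = l2_inner (grad (cayley_pairs S) F) c'"
  shows "c = c'"
proof -
  let ?d = "\<lambda>x. c x - c' x"
  have d: "?d \<in> closed_forms (cayley_edges G S)"
    by (rule closed_subspaceD(6)[OF closed_subspace_closed_forms c])
  note dl2 = closed_formsD(1)[OF d]
  obtain F where F: "?d = grad (cayley_pairs S) F" by (rule cayley_closed_form_is_grad[OF S d])
  have "l2_inner ?d c = l2_inner ?d c'"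
    unfolding F by (rule eq) (use dl2 F in simp)
  then have "l2_inner ?d ?d = 0"
    using l2_inner_diff_right[OF closed_formsD(1)[OF c(1)] closed_formsD(1)[OF c(2)] dl2] by simp
  from l2_inner_self_eq_0D[OF dl2 this] show ?thesis by auto
qed

text \<open>The functional sends the \<open>S\<close>-gradient of \<open>F\<close> to the product of
  its \<open>T\<close>-gradient with \<open>h\<close>. The comparison of gradients makes it both
  well defined and bounded, so it has a representing vector.\<close>

lemma transfer_exists:
  assumes S: "finite_generating_set G S" and T: "finite_generating_set G T" and h: "h \<in> l2 UNIV"
  obtains c where "c \<in> closed_forms (cayley_edges G S)"
    and "\<And>F. grad (cayley_pairs S) F \<in> l2 UNIV \<Longrightarrow>
      l2_inner (grad (cayley_pairs S) F) c = l2_inner (grad (cayley_pairs T) F) h"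
proof -
  let ?DS = "grad (cayley_pairs S)" and ?DT = "grad (cayley_pairs T)"
  obtain C where CT: "\<And>F. ?DS F \<in> l2 UNIV \<Longrightarrow> ?DT F \<in> l2 UNIV"
    and C: "\<And>F. ?DS F \<in> l2 UNIV \<Longrightarrow> l2_norm (?DT F) \<le> C * l2_norm (?DS F)"
    using grad_comparison[OF S T] by metis
  define pot where "pot f = (SOME F. f = ?DS F)" for f
  define \<phi> where "\<phi> f = l2_inner (?DT (pot f)) h" for f
  have \<phi>: "\<phi> (?DS F) = l2_inner (?DT F) h" for F
  proof -
    \<comment> \<open>The chosen potential and \<open>F\<close> have the same
      \<open>S\<close>-gradient, so their difference has \<open>S\<close>-gradient zero; by
      comparison its \<open>T\<close>-gradient has norm zero.\<close>
    let ?D = "\<lambda>x. pot (?DS F) x + (- 1) * F x"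
    have "?DS (pot (?DS F)) = ?DS F"
      unfolding pot_def by (rule someI2[of _ F]) auto
    then have 0: "?DS ?D = (\<lambda>_. 0)" unfolding grad_lincomb by simp
    then have "?DT ?D \<in> l2 UNIV" "l2_norm (?DT ?D) \<le> 0"
      using CT[of ?D] C[of ?D] by simp_all
    then have "?DT ?D \<in> l2 UNIV" "l2_norm (?DT ?D) = 0"
      using l2_norm_ge_0[of "?DT ?D"] by (simp_all only: order.antisym)
    from l2_norm_eq_0D[OF this] have "?DT (pot (?DS F)) = ?DT F"
      unfolding grad_lincomb by auto
    then show ?thesis by (simp add: \<phi>_def)
  qed
  obtain c where c: "c \<in> closed_forms (cayley_edges G S)"
    and rep: "\<And>f. f \<in> closed_forms (cayley_edges G S) \<Longrightarrow> \<phi> f = l2_inner f c"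
  proof (rule Riesz_representation[OF closed_subspace_closed_forms, of "cayley_edges G S" \<phi> "C * l2_norm h"])
    fix f g a assume f: "f \<in> closed_forms (cayley_edges G S)" and g: "g \<in> closed_forms (cayley_edges G S)"
    obtain F where F: "f = ?DS F" by (rule cayley_closed_form_is_grad[OF S f])
    obtain F' where F': "g = ?DS F'" by (rule cayley_closed_form_is_grad[OF S g])
    have l2: "?DT F \<in> l2 UNIV" "?DT F' \<in> l2 UNIV"
      using CT closed_formsD(1)[OF f] closed_formsD(1)[OF g] F F' by auto
    show "\<phi> (\<lambda>x. f x + a * g x) = \<phi> f + a * \<phi> g"
      unfolding F F' grad_lincomb[symmetric] \<phi> unfolding grad_lincomb
      by (rule l2_inner_lincomb_left[OF l2 h])
    have "cmod (\<phi> f) \<le> l2_norm (?DT F) * l2_norm h"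
      unfolding F \<phi> by (rule l2_Cauchy_Schwarz[OF l2(1) h])
    also have "\<dots> \<le> C * l2_norm f * l2_norm h"
      unfolding F using closed_formsD(1)[OF f] F by (intro mult_right_mono C) auto
    finally show "cmod (\<phi> f) \<le> C * l2_norm h * l2_norm f" by (simp add: mult_ac)
  qed (rule that)
  have "l2_inner (?DS F) c = l2_inner (?DT F) h" if "?DS F \<in> l2 UNIV" for F
    using rep[OF grad_in_closed_forms[OF finite_cayley_neighbours[OF S] that]] by (simp add: \<phi>)
  with c show thesis by (rule that)
qed

lemma transfer_eqI:
  assumes S: "finite_generating_set G S"
    and c: "c \<in> closed_forms (cayley_edges G S)"
    and eq: "\<And>F. grad (cayley_pairs S) F \<in> l2 UNIV \<Longrightarrow>
      l2_inner (grad (cayley_pairs S) F) c = l2_inner (grad (cayley_pairs T) F) h"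
  shows "transfer G S T h = c"
  unfolding transfer_def
proof (rule the_equality)
  fix c' assume "c' \<in> closed_forms (cayley_edges G S) \<and>
     (\<forall>F. grad (cayley_pairs S) F \<in> l2 UNIV \<longrightarrow>
       l2_inner (grad (cayley_pairs S) F) c' = l2_inner (grad (cayley_pairs T) F) h)"
  then have c': "c' \<in> closed_forms (cayley_edges G S)"
    and eq': "\<And>F. grad (cayley_pairs S) F \<in> l2 UNIV \<Longrightarrow>
       l2_inner (grad (cayley_pairs S) F) c' = l2_inner (grad (cayley_pairs T) F) h" by simp_all
  show "c' = c" by (rule transfer_unique[OF S c' c]) (simp only: eq eq')
qed (use c eq in simp)

lemma transfer:
  assumes S: "finite_generating_set G S" and T: "finite_generating_set G T" and h: "h \<in> l2 UNIV"
  shows "transfer G S T h \<in> closed_forms (cayley_edges G S)"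
    and "grad (cayley_pairs S) F \<in> l2 UNIV \<Longrightarrow>
      l2_inner (grad (cayley_pairs S) F) (transfer G S T h) = l2_inner (grad (cayley_pairs T) F) h"
proof -
  obtain c where c: "c \<in> closed_forms (cayley_edges G S)"
    and eq: "\<And>F. grad (cayley_pairs S) F \<in> l2 UNIV \<Longrightarrow>
      l2_inner (grad (cayley_pairs S) F) c = l2_inner (grad (cayley_pairs T) F) h"
    by (rule transfer_exists[OF assms]) blast
  have "transfer G S T h = c" by (rule transfer_eqI[OF S c eq])
  then show "transfer G S T h \<in> closed_forms (cayley_edges G S)"
    and "grad (cayley_pairs S) F \<in> l2 UNIV \<Longrightarrow>
      l2_inner (grad (cayley_pairs S) F) (transfer G S T h) = l2_inner (grad (cayley_pairs T) F) h"
    using c eq by auto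
qed

lemma transfer_harmonic:
  assumes S: "finite_generating_set G S" and T: "finite_generating_set G T"
    and h: "h \<in> harmonic_forms (cayley_edges G T)"
  shows "transfer G S T h \<in> harmonic_forms (cayley_edges G S)"
proof -
  have hD: "h \<in> closed_forms (cayley_edges G T)" using h harmonic_forms_subset by blast
  note tr = transfer[OF S T closed_formsD(1)[OF hD]]
  note indS = grad_indicator[OF finite_cayley_neighbours[OF S]]
    and indT = grad_indicator[OF finite_cayley_neighbours[OF T]]
  have "(\<Sum>y | {v, y} \<in> cayley_edges G S. transfer G S T h (v, y)) = 0" for v
  proof -
    have "l2_inner h (grad (cayley_pairs T) (indicator {v})) = 0"
      using indT(2)[OF hD] h[unfolded harmonic_forms_iff] by simp
    then have "l2_inner (transfer G S T h) (grad (cayley_pairs S) (indicator {v})) = 0"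
      using tr(2)[OF indS(1)] l2_inner_commute by (metis complex_cnj_zero)
    then show ?thesis using indS(2)[OF tr(1), of v] by simp
  qed
  then show ?thesis using tr(1) by (simp add: harmonic_forms_iff)
qed

lemma bounded_equivariant_transfer:
  assumes S: "finite_generating_set G S" and T: "finite_generating_set G T"
  shows "bounded_equivariant G (harmonic_forms (cayley_edges G T)) (harmonic_forms (cayley_edges G S))
    (transfer G S T)"
  unfolding bounded_equivariant_def
proof (intro conjI ballI allI)
  let ?H = "harmonic_forms (cayley_edges G T)"
  let ?DS = "grad (cayley_pairs S)" and ?DT = "grad (cayley_pairs T)"
  note XS = left_invariant_cayley_pairs[OF finite_generating_setD(2)[OF S]]
    and XT = left_invariant_cayley_pairs[OF finite_generating_setD(2)[OF T]]
  have Hl2: "h \<in> l2 (cayley_pairs T)" "h \<in> l2 UNIV" if "h \<in> ?H" for h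
    using that harmonic_forms_subset closed_forms_l2 l2_subset_UNIV by blast+
  obtain C where CT: "\<And>F. ?DS F \<in> l2 UNIV \<Longrightarrow> ?DT F \<in> l2 UNIV"
    and C: "\<And>F. ?DS F \<in> l2 UNIV \<Longrightarrow> l2_norm (?DT F) \<le> C * l2_norm (?DS F)"
    using grad_comparison[OF S T] by metis
  show "transfer G S T h \<in> harmonic_forms (cayley_edges G S)" if "h \<in> ?H" for h
    by (rule transfer_harmonic[OF S T that])
  show "transfer G S T (\<lambda>x. f x + a * h x) = (\<lambda>x. transfer G S T f x + a * transfer G S T h x)"
    if f: "f \<in> ?H" and h: "h \<in> ?H" for f h a
  proof (rule transfer_eqI[OF S])
    note tf = transfer[OF S T Hl2(2)[OF f]] and th = transfer[OF S T Hl2(2)[OF h]]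
    show "(\<lambda>x. transfer G S T f x + a * transfer G S T h x) \<in> closed_forms (cayley_edges G S)"
      by (rule closed_subspaceD(3)[OF closed_subspace_closed_forms tf(1) th(1)])
    fix F assume F: "?DS F \<in> l2 UNIV"
    have "l2_inner (?DS F) (\<lambda>x. transfer G S T f x + a * transfer G S T h x) =
        l2_inner (?DS F) (transfer G S T f) + cnj a * l2_inner (?DS F) (transfer G S T h)"
      by (rule l2_inner_lincomb_right[OF closed_formsD(1)[OF tf(1)] closed_formsD(1)[OF th(1)] F])
    also have "\<dots> = l2_inner (?DT F) f + cnj a * l2_inner (?DT F) h"
      by (simp only: tf(2)[OF F] th(2)[OF F])
    also have "\<dots> = l2_inner (?DT F) (\<lambda>x. f x + a * h x)"
      by (rule l2_inner_lincomb_right[OF Hl2(2)[OF f] Hl2(2)[OF h] CT[OF F], symmetric])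
    finally show "l2_inner (?DS F) (\<lambda>x. transfer G S T f x + a * transfer G S T h x) =
        l2_inner (?DT F) (\<lambda>x. f x + a * h x)" .
  qed
  show "\<exists>C. \<forall>h\<in>?H. l2_norm (transfer G S T h) \<le> C * l2_norm h"
  proof (intro exI ballI)
    fix h assume h: "h \<in> ?H"
    let ?c = "transfer G S T h"
    note th = transfer[OF S T Hl2(2)[OF h]]
    note cl2 = closed_formsD(1)[OF th(1)]
    \<comment> \<open>The image is a gradient, so the adjoint relation can be applied to the image
      itself; this bounds its squared norm by \<open>C\<close> times its norm times that of
      \<open>h\<close>.\<close>
    obtain F where F: "?c = ?DS F" by (rule cayley_closed_form_is_grad[OF S th(1)])
    have Fl2: "?DS F \<in> l2 UNIV" using cl2 F by simp
    have "(l2_norm ?c)\<^sup>2 = cmod (l2_inner (?DS F) ?c)"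
      unfolding F[symmetric] l2_inner_self by (simp only: norm_of_real abs_of_nonneg zero_le_power2)
    also have "\<dots> = cmod (l2_inner (?DT F) h)" by (simp only: th(2)[OF Fl2])
    also have "\<dots> \<le> l2_norm (?DT F) * l2_norm h" by (rule l2_Cauchy_Schwarz[OF CT[OF Fl2] Hl2(2)[OF h]])
    also have "\<dots> \<le> C * l2_norm ?c * l2_norm h"
      using C[OF Fl2] F by (intro mult_right_mono) auto
    finally have le: "l2_norm ?c * l2_norm ?c \<le> l2_norm ?c * (C * l2_norm h)"
      by (simp add: power2_eq_square mult_ac)
    \<comment> \<open>If the image is zero there is nothing to divide by and nothing forces
      \<open>C\<close> to be nonnegative, hence the absolute value.\<close>
    show "l2_norm ?c \<le> \<bar>C\<bar> * l2_norm h"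
    proof (cases "l2_norm ?c = 0")
      case False
      then have "l2_norm ?c > 0" using l2_norm_ge_0[of ?c] by linarith
      with le have "l2_norm ?c \<le> C * l2_norm h" by simp
      also have "\<dots> \<le> \<bar>C\<bar> * l2_norm h" by (intro mult_right_mono) auto
      finally show ?thesis .
    qed simp
  qed
  show "transfer G S T (translate G g h) = translate G g (transfer G S T h)"
    if g: "g \<in> carrier G" and h: "h \<in> ?H" for g h
  proof (rule transfer_eqI[OF S])
    note th = transfer[OF S T Hl2(2)[OF h]]
    show "translate G g (transfer G S T h) \<in> closed_forms (cayley_edges G S)"
      using translation_invariant_closed_forms[OF S] th(1) g unfolding translation_invariant_def by blast
    fix F assume F: "?DS F \<in> l2 UNIV"
    \<comment> \<open>Equivariance of the adjoint: translation by \<open>g\<close> is moved onto the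
      gradient as translation by the inverse, where it only changes the potential, and moved back on
      the side of \<open>T\<close>.\<close>
    have move: "l2_inner f (translate G g k) = l2_inner (translate G (inv g) f) k"
      if "left_invariant G X" "f \<in> l2 X" "k \<in> l2 X" for X f k
      using l2_inner_translate_left[OF that(1) inv_closed[OF g] that(2,3)] g by simp
    let ?F = "\<lambda>x. F (inv g \<otimes> x)"
    have "l2_inner (?DS F) (translate G g (transfer G S T h)) = l2_inner (?DS ?F) (transfer G S T h)"
      using move[OF XS grad_l2[OF F] subsetD[OF closed_forms_l2 th(1)]]
        translate_grad[OF XS inv_closed[OF g]] by simp
    also have "\<dots> = l2_inner (?DT ?F) h"
    proof (rule th(2))
      show "?DS ?F \<in> l2 UNIV"
        using l2_subset_UNIV[OF translate_l2(1)[OF XS inv_closed[OF g] grad_l2[OF F]]]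
          translate_grad[OF XS inv_closed[OF g]] by simp
    qed
    also have "\<dots> = l2_inner (?DT F) (translate G g h)"
      using move[OF XT grad_l2[OF CT[OF F]] Hl2(1)[OF h]]
        translate_grad[OF XT inv_closed[OF g]] by simp
    finally show "l2_inner (?DS F) (translate G g (transfer G S T h)) = l2_inner (?DT F) (translate G g h)" .
  qed
qed

text \<open>The relation defining \<open>transfer\<close> equates an inner product for
  \<open>S\<close> with one for \<open>T\<close> and reads the same from both sides, so
  \<open>h\<close> is the solution of the reverse problem.\<close>

lemma transfer_transfer:
  assumes S: "finite_generating_set G S" and T: "finite_generating_set G T"
    and h: "h \<in> harmonic_forms (cayley_edges G T)"
  shows "transfer G T S (transfer G S T h) = h"
proof (rule transfer_eqI[OF T])
  show hD: "h \<in> closed_forms (cayley_edges G T)" using h harmonic_forms_subset by blast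
  fix F assume F: "grad (cayley_pairs T) F \<in> l2 UNIV"
  have "grad (cayley_pairs S) F \<in> l2 UNIV"
    by (rule grad_comparison[OF T S]) (use F in simp)
  from transfer(2)[OF S T closed_formsD(1)[OF hD] this]
  show "l2_inner (grad (cayley_pairs T) F) h = l2_inner (grad (cayley_pairs S) F) (transfer G S T h)"
    by simp
qed

section \<open>The Betti number: independence and the isoperimetric bound\<close>

lemma l2_betti_1_eq:
  "l2_betti_1 G S = vn_dim {e \<in> cayley_pairs S. fst e = \<one>} (harmonic_forms (cayley_edges G S))"
  by (simp add: l2_betti_1_def harmonic_forms_def Let_def)

lemma harmonic_forms_Hilbert_module:
  assumes S: "finite_generating_set G S"
  shows "left_invariant G (cayley_pairs S)"
    and "closed_subspace (harmonic_forms (cayley_edges G S))"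
    and "harmonic_forms (cayley_edges G S) \<subseteq> l2 (cayley_pairs S)"
    and "translation_invariant G (harmonic_forms (cayley_edges G S))"
  by (rule left_invariant_cayley_pairs[OF finite_generating_setD(2)[OF S]]
      closed_subspace_harmonic_forms[OF finite_cayley_neighbours[OF S]]
      subset_trans[OF harmonic_forms_subset closed_forms_l2]
      translation_invariant_harmonic_forms[OF S])+

lemma l2_betti_1_independent:
  assumes S: "finite_generating_set G S" and T: "finite_generating_set G T"
  shows "l2_betti_1 G S = l2_betti_1 G T"
  unfolding l2_betti_1_eq
  by (rule vn_dim_isomorphic[OF harmonic_forms_Hilbert_module(1)[OF S] finite_cayley_base[OF S]
        harmonic_forms_Hilbert_module(2-4)[OF S]
        harmonic_forms_Hilbert_module(1)[OF T] finite_cayley_base[OF T]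
        harmonic_forms_Hilbert_module(2-4)[OF T]
        bounded_equivariant_transfer[OF T S] bounded_equivariant_transfer[OF S T]
        transfer_transfer[OF T S] transfer_transfer[OF S T]])

text \<open>The diagonal coefficients over the edges starting in \<open>A\<close> are added up
  twice: by invariance they give \<open>card A\<close> times the dimension, by the rank estimate at
  most the size of the boundary.\<close>

lemma l2_betti_1_le_isoperimetric_constant:
  assumes S: "finite_generating_set G S"
  shows "l2_betti_1 G S \<le> isoperimetric_constant (carrier G) (cayley_edges G S)"
  unfolding isoperimetric_constant_def
proof (rule cINF_greatest)
  show "{A. A \<subseteq> carrier G \<and> finite A \<and> A \<noteq> {}} \<noteq> {}"
    using one_closed by (auto intro!: exI[of _ "{\<one>}"])
next
  fix A assume "A \<in> {A. A \<subseteq> carrier G \<and> finite A \<and> A \<noteq> {}}"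
  then have A: "A \<subseteq> carrier G" "finite A" "card A > 0" by (auto simp: card_gt_0_iff)
  have "card A * l2_betti_1 G S \<le> card (edge_boundary (cayley_edges G S) A)"
    using sum_harmonic_diagonal_le_boundary[OF finite_cayley_neighbours[OF S] A(2)]
      sum_orth_proj_diagonal_translates[OF harmonic_forms_Hilbert_module[OF S] A(1)]
    by (simp add: l2_betti_1_eq)
  then show "l2_betti_1 G S \<le> real (card (edge_boundary (cayley_edges G S) A)) / real (card A)"
    using A(3) by (simp add: pos_le_divide_eq mult.commute)
qed

end

theorem theorem2:
  fixes G :: "('a, 'b) monoid_scheme" and T :: "'a set"
  assumes "group G"
    and "finite_generating_set G T"
  shows "l2_betti_1 G T \<le> uniform_isoperimetric_constant G"
proof -
  interpret group G by fact
  show ?thesis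
    unfolding uniform_isoperimetric_constant_def
  proof (rule cINF_greatest)
    show "{S. finite_generating_set G S} \<noteq> {}" using assms(2) by auto
    show "l2_betti_1 G T \<le> isoperimetric_constant (carrier G) (cayley_edges G S)"
      if "S \<in> {S. finite_generating_set G S}" for S
      using l2_betti_1_le_isoperimetric_constant[of S] l2_betti_1_independent[OF assms(2), of S] that
      by simp
  qed
qed

end
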